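(* Let $\nu\in(0,1]$ and $h,\lambda>0$. Let $\{T_n:n\geq 1\}$ be i.i.d. random variables with density $f_{\nu,h,\lambda}(t)=\lambda^h t^{\nu h-1}E_{\nu,\nu h}^h(-\lambda t^\nu)1_{(0,\infty)}(t)$, and let $\bar{T}_n:=\frac{T_1+\cdots+T_n}{n}$ for all $n\geq 1$. Then the sequence $\{\bar{T}_n:n\geq 1\}$ of real random variables satisfies the large deviation principle (as $n\to\infty$, with speed $n$) with rate function $I_{\nu,h,\lambda}^{(T)}$ defined by $$I_{\nu,h,\lambda}^{(T)}(x):=\sup_{\theta\in\mathbb{R}}\{\theta x-\kappa_{\nu,h,\lambda}(\theta)\},\qquad x\in\mathbb{R},$$ where $\kappa_{\nu,h,\lambda}(\theta):=\log\mathbb{E}[e^{\theta T_1}]$. In particular, for $\nu=1$, $$I_{1,h,\lambda}^{(T)}(x)=\begin{cases}h\left(\frac{\lambda x}{h}-1-\log\frac{\lambda x}{h}\right)&\text{if } x>0\\ \infty&\text{if } x\leq 0,\end{cases}$$ and it is a good rate function. For $\nu\in(0,1)$: $I_{\nu,h,\lambda}^{(T)}(x)=\infty$ for $x\leq 0$; $I_{\nu,h,\lambda}^{(T)}$ is decreasing on $(0,\infty)$; $\lim_{x\downarrow 0}I_{\nu,h,\lambda}^{(T)}(x)=\infty$; $\lim_{x\to\infty}I_{\nu,h,\lambda}^{(T)}(x)=0$; and the rate function $I_{\nu,h,\lambda}^{(T)}$ is not good.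
   Context: Generalized Mittag-Leffler function: $E_{\alpha,\beta}^\gamma(x):=\sum_{r\geq 0}\frac{(\gamma)_r x^r}{r!\,\Gamma(\alpha r+\beta)}$, where $(\gamma)_0:=1$ and $(\gamma)_r:=\gamma(\gamma+1)\cdots(\gamma+r-1)$ for $r\geq 1$. It is known that $f_{\nu,h,\lambda}$ is a probability density and that, for $\nu\in(0,1)$, $\log\mathbb{E}[e^{\theta T_1}]=h\log\frac{\lambda}{\lambda+(-\theta)^\nu}$ if $\theta\leq 0$ and $=\infty$ if $\theta>0$; for $\nu=1$ (Gamma density), $\log\mathbb{E}[e^{\theta T_1}]=h\log\frac{\lambda}{\lambda-\theta}$ if $\theta<\lambda$ and $=\infty$ if $\theta\geq\lambda$. Large deviation principle (LDP): a sequence $\{Z_n:n\geq 1\}$ of random variables with values in a topological space $\mathcal{Z}$ satisfies the LDP with rate function $I:\mathcal{Z}\to[0,\infty]$ if $I$ is lower semi-continuous, $\limsup_{n\to\infty}\frac{1}{n}\log P(Z_n\in C)\leq-\inf_{x\in C}I(x)$ for all closed sets $C$, and $\liminf_{n\to\infty}\frac{1}{n}\log P(Z_n\in G)\geq-\inf_{x\in G}I(x)$ for all open sets $G$. The rate function $I$ is good if all its level sets $\{x\in\mathcal{Z}:I(x)\leq\eta\}$, $\eta\geq 0$, are compact. Here $\mathcal{Z}=\mathbb{R}$. *)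

theory Defs
  imports "HOL-Probability.Probability"
begin

definition mittag_leffler :: "real \<Rightarrow> real \<Rightarrow> real \<Rightarrow> real \<Rightarrow> real" where
  "mittag_leffler \<alpha> \<beta> \<gamma> x =
     (\<Sum>r. pochhammer \<gamma> r * x ^ r / (fact r * Gamma (\<alpha> * real r + \<beta>)))"

definition ml_density :: "real \<Rightarrow> real \<Rightarrow> real \<Rightarrow> real \<Rightarrow> real" where
  "ml_density \<nu> h lam t =
     lam powr h * t powr (\<nu> * h - 1) * mittag_leffler \<nu> (\<nu> * h) h (- lam * t powr \<nu>)
       * indicator {0<..} t"

(* Logarithm on [0,\<infinity>] with log 0 = -\<infinity> and log \<infinity> = \<infinity>; the library's ln on the reals
   has ln 0 = 0, which would be wrong for probabilities of null events. *)
definition ext_ln :: "ennreal \<Rightarrow> ereal" where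
  "ext_ln p = (if p = 0 then -\<infinity> else if p = \<top> then \<infinity> else ereal (ln (enn2real p)))"

definition log_mgf :: "'a measure \<Rightarrow> ('a \<Rightarrow> real) \<Rightarrow> real \<Rightarrow> ereal" where
  "log_mgf M X \<theta> = ext_ln (\<integral>\<^sup>+ \<omega>. ennreal (exp (\<theta> * X \<omega>)) \<partial>M)"

definition fenchel_legendre :: "(real \<Rightarrow> ereal) \<Rightarrow> real \<Rightarrow> ereal" where
  "fenchel_legendre \<kappa> x = (SUP \<theta>. ereal (\<theta> * x) - \<kappa> \<theta>)"

definition lower_semicontinuous :: "('b::topological_space \<Rightarrow> ereal) \<Rightarrow> bool" where
  "lower_semicontinuous I \<longleftrightarrow> (\<forall>x a. a < I x \<longrightarrow> (\<forall>\<^sub>F y in nhds x. a < I y))"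

definition rate_function :: "('b::topological_space \<Rightarrow> ereal) \<Rightarrow> bool" where
  "rate_function I \<longleftrightarrow> (\<forall>x. 0 \<le> I x) \<and> lower_semicontinuous I"

(* Sequences are indexed by n \<ge> 1: the value Z 0 plays no role. *)
definition satisfies_LDP ::
    "'a measure \<Rightarrow> (nat \<Rightarrow> 'a \<Rightarrow> 'b::topological_space) \<Rightarrow> ('b \<Rightarrow> ereal) \<Rightarrow> bool" where
  "satisfies_LDP M Z I \<longleftrightarrow>
     prob_space M \<and> (\<forall>n\<ge>1. Z n \<in> borel_measurable M) \<and> rate_function I \<and>
     (\<forall>C. closed C \<longrightarrow>
        limsup (\<lambda>n. ereal (1 / real n) * ext_ln (emeasure M {\<omega> \<in> space M. Z n \<omega> \<in> C}))
          \<le> - (INF x\<in>C. I x)) \<and>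
     (\<forall>G. open G \<longrightarrow>
        liminf (\<lambda>n. ereal (1 / real n) * ext_ln (emeasure M {\<omega> \<in> space M. Z n \<omega> \<in> G}))
          \<ge> - (INF x\<in>G. I x))"

definition compact_level_sets :: "('b::topological_space \<Rightarrow> ereal) \<Rightarrow> bool" where
  "compact_level_sets I \<longleftrightarrow> (\<forall>\<eta>::real. 0 \<le> \<eta> \<longrightarrow> compact {x. I x \<le> ereal \<eta>})"

definition good_rate_function :: "('b::topological_space \<Rightarrow> ereal) \<Rightarrow> bool" where
  "good_rate_function I \<longleftrightarrow> rate_function I \<and> compact_level_sets I"

definition sample_mean :: "(nat \<Rightarrow> 'a \<Rightarrow> real) \<Rightarrow> nat \<Rightarrow> 'a \<Rightarrow> real" where
  "sample_mean T n \<omega> = (\<Sum>i=1..n. T i \<omega>) / real n"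

end

theory Submission
  imports Defs "HOL-Complex_Analysis.Complex_Analysis" "HOL-Real_Asymp.Real_Asymp"
begin

text \<open>
  Cramer's theorem: the upper bound is Chernoff's inequality on half lines; the lower bound at \<open>x\<close>
  comes from tilting by a \<open>\<theta>\<close> with \<open>\<kappa>' \<theta> = x\<close>, and such a \<open>\<theta>\<close> exists for every \<open>x > 0\<close>, while
  the rate is infinite for \<open>x \<le> 0\<close>.

  The cumulant generating function is found by integrating the Mittag-Leffler series termwise
  against \<open>exp (- s * t)\<close>. This gives \<open>(lam / (lam + s powr \<nu>)) powr h\<close>, but only for
  \<open>s powr \<nu> > lam\<close>; the formula extends to all \<open>s > 0\<close> by analytic continuation, using that the
  positive part of the density has mass one. For \<open>\<nu> < 1\<close> its slope at \<open>0\<close> is infinite, so no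
  positive exponential moment is finite, and the supremum over \<open>\<theta> \<le> 0\<close> is attained at an interior
  point, whence the strict monotonicity of the rate.
\<close>

section \<open>Cramer's theorem on the real line\<close>

text \<open>The hypotheses do not say that \<open>ml_density\<close> is nonnegative. In
  \<open>distributed\<close>, the density enters through \<open>ennreal\<close>, which cuts negative
  values to zero: the law of \<open>T n\<close> has the positive part as density, whereas termwise
  integration yields the transform of the signed function. The continuation therefore has two tasks,
  to reach small \<open>s\<close> and to show that the negative part vanishes.

  For \<nu> = 1 the transform is also finite for \<theta> between 0 and \<open>lam\<close>, which
  the continuation does not reach; there the density has a closed form that is integrated directly.

  For \<nu> < 1 the rate is not good, so exponential tightness fails and closed sets cannot be
  reduced to compact ones. This is the reason for covering by half lines in the upper bound. For the
  lower bound, the slope of the cumulant function runs through all of the positive reals inside its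
  domain: towards \<open>lam\<close> it tends to infinity for \<nu> = 1, towards 0 for \<nu> < 1,
  and it tends to 0 at minus infinity in both cases.\<close>

lemma ereal_le_uminus_reorder: "a \<le> - b \<longleftrightarrow> b \<le> - a" for a b :: ereal
  by (cases a; cases b) auto

lemma ext_ln_ereal: "0 < r \<Longrightarrow> ext_ln (ennreal r) = ereal (ln r)"
  by (simp add: ext_ln_def)

lemma ext_ln_mono: "a \<le> b \<Longrightarrow> ext_ln a \<le> ext_ln b"
  unfolding ext_ln_def
  by (cases a; cases b) (auto simp: ennreal_le_iff2 top_unique ennreal_eq_0_iff)

lemma ext_ln_eq_ereal_iff: "ext_ln p = ereal r \<longleftrightarrow> p = ennreal (exp r)"
  unfolding ext_ln_def by (cases p) (auto simp: ennreal_eq_0_iff)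

lemma ext_ln_top [simp]: "ext_ln \<top> = \<infinity>"
  by (simp add: ext_ln_def)

lemma fenchel_legendre_upper: "ereal (\<theta> * x) - \<kappa> \<theta> \<le> fenchel_legendre \<kappa> x"
  unfolding fenchel_legendre_def by (rule SUP_upper) simp

text \<open>A supremum of functions that are continuous in \<open>x\<close>: affine where
  \<open>\<kappa> \<theta>\<close> is finite, constantly infinite otherwise.\<close>

lemma lower_semicontinuous_fenchel_legendre: "lower_semicontinuous (fenchel_legendre \<kappa>)"
  unfolding lower_semicontinuous_def
proof (intro allI impI)
  fix x a
  assume "a < fenchel_legendre \<kappa> x"
  then obtain \<theta> where \<theta>: "a < ereal (\<theta> * x) - \<kappa> \<theta>"
    unfolding fenchel_legendre_def less_SUP_iff by blast
  have "((\<lambda>y. ereal (\<theta> * y) - \<kappa> \<theta>) \<longlongrightarrow> ereal (\<theta> * x) - \<kappa> \<theta>) (nhds x)"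
  proof (cases "\<kappa> \<theta>")
    case (real r)
    have "((\<lambda>y. ereal (\<theta> * y - r)) \<longlongrightarrow> ereal (\<theta> * x - r)) (nhds x)"
      by (intro tendsto_intros filterlim_ident)
    then show ?thesis by (simp add: real)
  qed simp_all
  from order_tendstoD(1)[OF this \<theta>]
  show "\<forall>\<^sub>F y in nhds x. a < fenchel_legendre \<kappa> y"
    by eventually_elim (rule less_le_trans[OF _ fenchel_legendre_upper])
qed

locale iid_sequence = prob_space M for M :: "'a measure" +
  fixes T :: "nat \<Rightarrow> 'a \<Rightarrow> real"
  assumes indep: "indep_vars (\<lambda>_. borel) T {1..}"
    and ident: "\<And>n. 1 \<le> n \<Longrightarrow> distr M borel (T n) = distr M borel (T 1)"
begin

lemma measurable_T [measurable]: "1 \<le> n \<Longrightarrow> T n \<in> borel_measurable M"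
  using indep unfolding indep_vars_def by auto

lemma measurable_sample_mean [measurable]: "sample_mean T n \<in> borel_measurable M"
  unfolding sample_mean_def by (intro borel_measurable_divide borel_measurable_sum) simp_all

definition mgf :: "real \<Rightarrow> ennreal" where
  "mgf \<theta> = (\<integral>\<^sup>+ \<omega>. ennreal (exp (\<theta> * T 1 \<omega>)) \<partial>M)"

lemma log_mgf_eq: "log_mgf M (T 1) \<theta> = ext_ln (mgf \<theta>)"
  by (simp add: log_mgf_def mgf_def)

lemma mgf_ident:
  assumes "1 \<le> n"
  shows "(\<integral>\<^sup>+ \<omega>. ennreal (exp (\<theta> * T n \<omega>)) \<partial>M) = mgf \<theta>"
proof -
  have "(\<integral>\<^sup>+ \<omega>. ennreal (exp (\<theta> * T m \<omega>)) \<partial>M)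
      = (\<integral>\<^sup>+ x. ennreal (exp (\<theta> * x)) \<partial>distr M borel (T m))" if "1 \<le> m" for m
    using that by (subst nn_integral_distr) simp_all
  from this[OF assms] this[of 1] show ?thesis
    by (simp add: ident[OF assms] mgf_def)
qed

lemma mgf_sample_mean:
  assumes "1 \<le> n"
  shows "(\<integral>\<^sup>+ \<omega>. ennreal (exp (real n * \<theta> * sample_mean T n \<omega>)) \<partial>M) = mgf \<theta> ^ n"
proof -
  have "ennreal (exp (real n * \<theta> * sample_mean T n \<omega>)) = (\<Prod>i\<in>{1..n}. ennreal (exp (\<theta> * T i \<omega>)))" for \<omega>
    using assms by (simp add: sample_mean_def prod_ennreal mult.assoc flip: exp_sum sum_distrib_left)
  moreover have "(\<integral>\<^sup>+ \<omega>. (\<Prod>i\<in>{1..n}. ennreal (exp (\<theta> * T i \<omega>))) \<partial>M)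
      = (\<Prod>i\<in>{1..n}. (\<integral>\<^sup>+ \<omega>. ennreal (exp (\<theta> * T i \<omega>)) \<partial>M))"
  proof (rule indep_vars_nn_integral)
    have "indep_vars (\<lambda>_. borel) T {1..n}"
      by (rule indep_vars_subset[OF indep]) auto
    then show "indep_vars (\<lambda>_. borel) (\<lambda>i \<omega>. ennreal (exp (\<theta> * T i \<omega>))) {1..n}"
      by (rule indep_vars_compose2) simp
  qed simp_all
  moreover have "\<dots> = (\<Prod>i\<in>{1..n}. mgf \<theta>)"
    by (intro prod.cong refl mgf_ident) simp
  ultimately show ?thesis by simp
qed

text \<open>On \<open>A\<close> the factor \<open>exp (n * \<eta> * (y - x))\<close> is at least 1
  and may be inserted. The weight with \<theta> is carried along so that one bound serves the law
  itself, with \<theta> = 0, and its exponential tilt.\<close>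

lemma chernoff:
  assumes "1 \<le> n" and "A \<in> sets borel" and "\<And>y. y \<in> A \<Longrightarrow> \<eta> * x \<le> \<eta> * y"
  shows "(\<integral>\<^sup>+ \<omega>. ennreal (exp (real n * \<theta> * sample_mean T n \<omega>)) * indicator A (sample_mean T n \<omega>) \<partial>M)
       \<le> ennreal (exp (- real n * \<eta> * x)) * mgf (\<theta> + \<eta>) ^ n"
proof -
  have "ennreal (exp (real n * \<theta> * y)) * indicator A y
      \<le> ennreal (exp (- real n * \<eta> * x)) * ennreal (exp (real n * (\<theta> + \<eta>) * y))" for y
  proof (cases "y \<in> A")
    case True
    then have "real n * (\<eta> * x) \<le> real n * (\<eta> * y)"
      by (intro mult_left_mono assms(3) True) simp
    then have "real n * \<theta> * y \<le> - real n * \<eta> * x + real n * (\<theta> + \<eta>) * y"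
      by (simp add: algebra_simps)
    then show ?thesis
      using True by (simp flip: ennreal_mult' exp_add)
  qed simp
  then have "(\<integral>\<^sup>+ \<omega>. ennreal (exp (real n * \<theta> * sample_mean T n \<omega>)) * indicator A (sample_mean T n \<omega>) \<partial>M)
      \<le> (\<integral>\<^sup>+ \<omega>. ennreal (exp (- real n * \<eta> * x)) * ennreal (exp (real n * (\<theta> + \<eta>) * sample_mean T n \<omega>)) \<partial>M)"
    by (intro nn_integral_mono)
  also have "\<dots> = ennreal (exp (- real n * \<eta> * x)) * mgf (\<theta> + \<eta>) ^ n"
    using assms(1) by (subst nn_integral_cmult) (simp_all add: mgf_sample_mean)
  finally show ?thesis .
qed

lemma mgf_0: "mgf 0 = 1"
  by (simp add: mgf_def emeasure_space_1)

lemma mgf_not_0: "mgf \<theta> \<noteq> 0"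
proof
  assume "mgf \<theta> = 0"
  then have "AE \<omega> in M. False"
    unfolding mgf_def by (subst (asm) nn_integral_0_iff_AE) auto
  then show False by simp
qed

lemma rate_function_fenchel_legendre: "rate_function (fenchel_legendre (log_mgf M (T 1)))"
proof -
  have "log_mgf M (T 1) 0 = 0"
    unfolding log_mgf_eq mgf_0 using ext_ln_ereal[of 1] by (simp add: zero_ereal_def)
  then have "0 \<le> fenchel_legendre (log_mgf M (T 1)) x" for x
    using fenchel_legendre_upper[of 0 x "log_mgf M (T 1)"] by (simp add: zero_ereal_def[symmetric])
  then show ?thesis
    by (simp add: rate_function_def lower_semicontinuous_fenchel_legendre)
qed

lemma chernoff_half_line:
  assumes "1 \<le> n" and "A \<in> sets borel" and "\<And>y. y \<in> A \<Longrightarrow> \<theta> * x \<le> \<theta> * y"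
    and a: "ereal a < ereal (\<theta> * x) - log_mgf M (T 1) \<theta>"
  shows "emeasure M {\<omega> \<in> space M. sample_mean T n \<omega> \<in> A} \<le> ennreal (exp (- real n * a))"
proof -
  \<comment> \<open>A real number below the difference excludes an infinite moment, and
    \<open>mgf_not_0\<close> excludes the logarithm minus infinity.\<close>
  from a obtain r where r: "mgf \<theta> = ennreal (exp r)" and "a < \<theta> * x - r"
  proof (cases "log_mgf M (T 1) \<theta>")
    case (real r)
    then have "mgf \<theta> = ennreal (exp r)" unfolding log_mgf_eq ext_ln_eq_ereal_iff .
    then show thesis using that a real by simp
  next
    case MInf
    then show thesis
      using mgf_not_0[of \<theta>] unfolding log_mgf_eq by (auto simp: ext_ln_def split: if_splits)
  qed (use a in simp_all)
  have [measurable]: "A \<in> sets borel" by fact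
  have "emeasure M {\<omega> \<in> space M. sample_mean T n \<omega> \<in> A}
      = (\<integral>\<^sup>+ \<omega>. indicator {\<omega> \<in> space M. sample_mean T n \<omega> \<in> A} \<omega> \<partial>M)"
    by simp
  also have "\<dots> = (\<integral>\<^sup>+ \<omega>. ennreal (exp (real n * 0 * sample_mean T n \<omega>)) * indicator A (sample_mean T n \<omega>) \<partial>M)"
    by (intro nn_integral_cong) (auto simp: indicator_def)
  also have "\<dots> \<le> ennreal (exp (- real n * \<theta> * x)) * mgf (0 + \<theta>) ^ n"
    by (rule chernoff) (use assms in auto)
  also have "\<dots> = ennreal (exp (- real n * (\<theta> * x - r)))"
    by (simp add: r ennreal_power algebra_simps flip: ennreal_mult exp_of_nat_mult exp_add)
  also have "\<dots> \<le> ennreal (exp (- real n * a))"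
    using \<open>a < \<theta> * x - r\<close> \<open>1 \<le> n\<close> by (intro ennreal_leI) (simp add: mult_left_mono)
  finally show ?thesis .
qed

text \<open>The half lines are nested, so even an uncountable union costs no more than one of them:
  it is the largest one if \<open>D\<close> has a maximum, and otherwise an increasing union along a
  sequence in \<open>D\<close> approaching the supremum, to which continuity from below applies.
  Taking the supremum in \<open>ereal\<close> admits unbounded \<open>D\<close>.\<close>

lemma emeasure_Union_half_lines_le:
  fixes X :: "'a \<Rightarrow> real"
  assumes [measurable]: "X \<in> borel_measurable M"
    and D: "\<And>x. x \<in> D \<Longrightarrow> emeasure M {\<omega> \<in> space M. X \<omega> \<le> x} \<le> c"
  shows "emeasure M {\<omega> \<in> space M. \<exists>x\<in>D. X \<omega> \<le> x} \<le> c"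
proof (cases "D = {}")
  case False
  obtain f :: "nat \<Rightarrow> ereal" where f: "incseq f" "range f \<subseteq> ereal ` D" "Sup (ereal ` D) = (SUP i. f i)"
    using Sup_countable_SUP[of "ereal ` D"] False by auto
  show ?thesis
  proof (cases "Sup (ereal ` D) \<in> ereal ` D")
    case True
    then obtain s where s: "s \<in> D" "Sup (ereal ` D) = ereal s" by auto
    have "x \<le> s" if "x \<in> D" for x
      using SUP_upper[OF that, of ereal] s by simp
    then have "{\<omega> \<in> space M. \<exists>x\<in>D. X \<omega> \<le> x} = {\<omega> \<in> space M. X \<omega> \<le> s}"
      using s(1) by (auto intro: order_trans)
    then show ?thesis using D s by simp
  next
    case notin: False
    define A where "A i = {\<omega> \<in> space M. ereal (X \<omega>) \<le> f i}" for i
    have A: "range A \<subseteq> sets M" unfolding A_def by auto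
    have "incseq A"
      using f(1) unfolding A_def incseq_def by (auto intro: order_trans)
    have "{\<omega> \<in> space M. \<exists>x\<in>D. X \<omega> \<le> x} = (\<Union>i. A i)"
    proof (intro equalityI subsetI)
      fix \<omega> assume "\<omega> \<in> {\<omega> \<in> space M. \<exists>x\<in>D. X \<omega> \<le> x}"
      then obtain x where x: "x \<in> D" "X \<omega> \<le> x" "\<omega> \<in> space M" by auto
      then have "ereal x < Sup (ereal ` D)"
        using notin SUP_upper[OF x(1), of ereal] by (metis imageI order_le_less x(1))
      then obtain i where "ereal x < f i" unfolding f(3) less_SUP_iff by auto
      then have "\<omega> \<in> A i" using x unfolding A_def
        by (metis (mono_tags, lifting) ereal_less_eq(3) less_imp_le mem_Collect_eq order_trans)
      then show "\<omega> \<in> (\<Union>i. A i)" by auto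
    next
      fix \<omega> assume "\<omega> \<in> (\<Union>i. A i)"
      then obtain i where i: "\<omega> \<in> space M" "ereal (X \<omega>) \<le> f i" by (auto simp: A_def)
      moreover obtain x where "x \<in> D" "f i = ereal x" using f(2) by auto
      ultimately show "\<omega> \<in> {\<omega> \<in> space M. \<exists>x\<in>D. X \<omega> \<le> x}" by auto
    qed
    moreover have "emeasure M (\<Union>i. A i) = (SUP i. emeasure M (A i))"
      using A \<open>incseq A\<close> by (rule SUP_emeasure_incseq[symmetric])
    moreover have "\<dots> \<le> c"
    proof (rule SUP_least)
      fix i
      obtain x where "x \<in> D" "f i = ereal x" using f(2) by auto
      then show "emeasure M (A i) \<le> c" using D by (simp add: A_def)
    qed
    ultimately show ?thesis by simp
  qed
qed simp

text \<open>
  Where \<open>I > a\<close>, the supremum defining \<open>I\<close> exceeds \<open>a\<close> already over \<open>\<theta> \<le> 0\<close> or over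
  \<open>\<theta> \<ge> 0\<close>. The points of the first kind are covered by half lines \<open>{..x}\<close>, those of the
  second kind by half lines \<open>{x..}\<close>, each of probability at most \<open>exp (- n * a)\<close>.
\<close>

lemma cramer_upper_finite:
  assumes n: "1 \<le> n" and C: "C \<in> sets borel"
    and a: "\<And>x. x \<in> C \<Longrightarrow> ereal a < fenchel_legendre (log_mgf M (T 1)) x"
  shows "emeasure M {\<omega> \<in> space M. sample_mean T n \<omega> \<in> C} \<le> ennreal (2 * exp (- real n * a))"
proof -
  note [measurable] = C
  define L where "L = {x. \<exists>\<theta>\<le>0. ereal a < ereal (\<theta> * x) - log_mgf M (T 1) \<theta>}"
  define R where "R = {x. \<exists>\<theta>\<ge>0. ereal a < ereal (\<theta> * x) - log_mgf M (T 1) \<theta>}"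
  let ?Z = "sample_mean T n"
  have CLR: "C \<subseteq> L \<union> R"
  proof
    fix x assume "x \<in> C"
    from a[OF this] obtain \<theta> where "ereal a < ereal (\<theta> * x) - log_mgf M (T 1) \<theta>"
      unfolding fenchel_legendre_def less_SUP_iff by blast
    then show "x \<in> L \<union> R" unfolding L_def R_def by (cases "\<theta> \<le> 0") auto
  qed
  have L: "emeasure M {\<omega> \<in> space M. \<exists>x\<in>L. ?Z \<omega> \<le> x} \<le> ennreal (exp (- real n * a))"
  proof (rule emeasure_Union_half_lines_le)
    fix x assume "x \<in> L"
    then obtain \<theta> where "\<theta> \<le> 0" "ereal a < ereal (\<theta> * x) - log_mgf M (T 1) \<theta>"
      unfolding L_def by auto
    then show "emeasure M {\<omega> \<in> space M. ?Z \<omega> \<le> x} \<le> ennreal (exp (- real n * a))"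
      using chernoff_half_line[OF n, of "{..x}" \<theta> x a] by (auto intro: mult_left_mono_neg)
  qed simp
  \<comment> \<open>Reflection turns right half lines into left ones.\<close>
  have R: "emeasure M {\<omega> \<in> space M. \<exists>x\<in>uminus ` R. - ?Z \<omega> \<le> x} \<le> ennreal (exp (- real n * a))"
  proof (rule emeasure_Union_half_lines_le)
    fix x assume "x \<in> uminus ` R"
    then obtain y \<theta> where "x = - y" "\<theta> \<ge> 0" "ereal a < ereal (\<theta> * y) - log_mgf M (T 1) \<theta>"
      unfolding R_def by auto
    then show "emeasure M {\<omega> \<in> space M. - ?Z \<omega> \<le> x} \<le> ennreal (exp (- real n * a))"
      using chernoff_half_line[OF n, of "{y..}" \<theta> y a] by (auto intro: mult_left_mono)
  qed simp
  \<comment> \<open>\<open>D\<close> is an arbitrary set here; a union of left half lines is Borel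
    because it is an interval.\<close>
  have meas: "{\<omega> \<in> space M. \<exists>x\<in>D. X \<omega> \<le> x} \<in> sets M"
    if [measurable]: "X \<in> borel_measurable M" for X and D :: "real set"
  proof -
    have "is_interval {y. \<exists>x\<in>D. y \<le> x}"
      unfolding is_interval_1 by (auto intro: order_trans)
    then have [measurable]: "{y. \<exists>x\<in>D. y \<le> x} \<in> sets borel"
      by (rule real_interval_borel_measurable)
    have "{\<omega> \<in> space M. X \<omega> \<in> {y. \<exists>x\<in>D. y \<le> x}} \<in> sets M" by measurable
    then show ?thesis by simp
  qed
  have "emeasure M {\<omega> \<in> space M. ?Z \<omega> \<in> C}
     \<le> emeasure M ({\<omega> \<in> space M. \<exists>x\<in>L. ?Z \<omega> \<le> x} \<union> {\<omega> \<in> space M. \<exists>x\<in>uminus ` R. - ?Z \<omega> \<le> x})"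
    using CLR by (intro emeasure_mono sets.Un meas) auto
  also have "\<dots> \<le> ennreal (exp (- real n * a)) + ennreal (exp (- real n * a))"
    by (rule order_trans[OF emeasure_subadditive add_mono[OF L R]]) (intro meas; simp)+
  also have "\<dots> = ennreal (2 * exp (- real n * a))"
    by (simp flip: ennreal_plus)
  finally show ?thesis .
qed

text \<open>Every real \<open>a\<close> below the infimum is admissible in
  \<open>cramer_upper_finite\<close>, and the factor 2 from the two sides contributes only
  \<open>ln 2 / n\<close>.\<close>

lemma cramer_upper:
  assumes "C \<in> sets borel"
  shows "limsup (\<lambda>n. ereal (1 / real n) * ext_ln (emeasure M {\<omega> \<in> space M. sample_mean T n \<omega> \<in> C}))
     \<le> - (INF x\<in>C. fenchel_legendre (log_mgf M (T 1)) x)"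
proof -
  let ?I = "fenchel_legendre (log_mgf M (T 1))"
  let ?p = "\<lambda>n. ereal (1 / real n) * ext_ln (emeasure M {\<omega> \<in> space M. sample_mean T n \<omega> \<in> C})"
  have "(INF x\<in>C. ?I x) \<le> - limsup ?p"
  proof (rule dense_le)
    fix b assume b: "b < (INF x\<in>C. ?I x)"
    show "b \<le> - limsup ?p"
    proof (cases b)
      case (real a)
      have "?p n \<le> ereal (ln 2 / real n - a)" if "n \<ge> 1" for n
      proof -
        have "ext_ln (emeasure M {\<omega> \<in> space M. sample_mean T n \<omega> \<in> C}) \<le> ext_ln (ennreal (2 * exp (- real n * a)))"
          using that assms b real less_INF_D[OF b]
          by (intro ext_ln_mono cramer_upper_finite) auto
        also have "\<dots> = ereal (ln 2 - real n * a)"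
          by (subst ext_ln_ereal) (simp_all add: ln_mult)
        finally have "?p n \<le> ereal (1 / real n) * ereal (ln 2 - real n * a)"
          by (rule ereal_mult_left_mono) simp
        also have "\<dots> = ereal (ln 2 / real n - a)"
          using that by (simp add: field_simps)
        finally show ?thesis .
      qed
      then have "limsup ?p \<le> limsup (\<lambda>n. ereal (ln 2 / real n - a))"
        by (intro Limsup_mono eventually_mono[OF eventually_ge_at_top[of 1]])
      also have "(\<lambda>n. ereal (ln 2 / real n - a)) \<longlonglongrightarrow> ereal (0 - a)"
        by (intro tendsto_intros lim_const_over_n)
      then have "limsup (\<lambda>n. ereal (ln 2 / real n - a)) = ereal (0 - a)"
        by (rule lim_imp_Limsup[OF sequentially_bot])
      finally show ?thesis
        using real by (cases "limsup ?p") auto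
    qed (use b in simp_all)
  qed
  then show ?thesis by (simp add: ereal_le_uminus_reorder[of "Inf _"])
qed

text \<open>
  With \<open>k' \<theta> = x\<close>, the exponentially tilted law has mean \<open>x\<close>; its tails are controlled by
  a second Chernoff bound, which only uses the moment generating function near \<open>\<theta>\<close>.
\<close>

lemma tilted_tail:
  assumes k: "\<And>\<eta>. \<bar>\<eta>\<bar> < e \<Longrightarrow> log_mgf M (T 1) (\<theta> + \<eta>) = ereal (k (\<theta> + \<eta>))" and "0 < e"
    and D: "(k has_real_derivative x) (at \<theta>)" and "0 < \<delta>" and s: "\<bar>s\<bar> = 1"
  obtains \<epsilon> where "0 < \<epsilon>"
    and "\<And>n. 1 \<le> n \<Longrightarrow> (\<integral>\<^sup>+ \<omega>. ennreal (exp (real n * \<theta> * sample_mean T n \<omega>))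
            * indicator {y. s * (y - x) \<ge> \<delta>} (sample_mean T n \<omega>) \<partial>M)
          \<le> ennreal (exp (real n * (k \<theta> - \<epsilon>)))"
proof -
  \<comment> \<open>The sign \<open>s\<close> selects the tail. \<open>g t\<close> is the exponent
    of the Chernoff bound with parameter \<open>s * t\<close>, relative to
    \<open>k \<theta>\<close>. Its slope at 0 is \<open>- \<delta>\<close>, because the slope
    \<open>x\<close> of \<open>k\<close> cancels, so a small positive \<open>t\<close> yields the
    gain \<epsilon> = \<open>- g t\<close>.\<close>
  define g where "g t = k (\<theta> + s * t) - s * t * x - t * \<delta> - k \<theta>" for t
  have "(g has_real_derivative (x * s - s * x - \<delta>)) (at 0)"
    unfolding g_def using D
    by (auto intro!: derivative_eq_intros DERIV_chain2[where f = k and g = "\<lambda>t. \<theta> + s * t" and x = 0])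
  moreover have "g 0 = 0" by (simp add: g_def)
  ultimately obtain d where d: "0 < d" "\<And>t. 0 < t \<Longrightarrow> t < d \<Longrightarrow> g t < 0"
    using DERIV_neg_dec_right[of g "x * s - s * x - \<delta>" 0] \<open>0 < \<delta>\<close> by auto
  define t where "t = min d e / 2"
  have t: "0 < t" "t < d" "t < e" using d(1) \<open>0 < e\<close> by (auto simp: t_def)
  have m: "mgf (\<theta> + s * t) = ennreal (exp (k (\<theta> + s * t)))"
    using k[of "s * t"] t s unfolding log_mgf_eq ext_ln_eq_ereal_iff by (simp add: abs_mult)
  show thesis
  proof
    show "0 < - g t" using d(2) t by simp
  next
    fix n :: nat assume n: "1 \<le> n"
    have s2: "s * s = 1" using s by (metis abs_mult_self_eq mult_1)
    have "(\<integral>\<^sup>+ \<omega>. ennreal (exp (real n * \<theta> * sample_mean T n \<omega>))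
            * indicator {y. s * (y - x) \<ge> \<delta>} (sample_mean T n \<omega>) \<partial>M)
      \<le> ennreal (exp (- real n * (s * t) * (x + s * \<delta>))) * mgf (\<theta> + s * t) ^ n"
    proof (rule chernoff)
      show "s * t * (x + s * \<delta>) \<le> s * t * y" if "y \<in> {y. s * (y - x) \<ge> \<delta>}" for y
      proof -
        have "t * \<delta> \<le> t * (s * (y - x))" using that t by (intro mult_left_mono) auto
        moreover have "s * t * (x + s * \<delta>) = s * t * x + (s * s) * (t * \<delta>)" by (simp add: algebra_simps)
        moreover have "t * (s * (y - x)) = s * t * y - s * t * x" by (simp add: algebra_simps)
        ultimately show ?thesis unfolding s2 by linarith
      qed
    qed (use n in simp_all)
    also have "\<dots> = ennreal (exp (- real n * (s * t) * (x + s * \<delta>) + real n * k (\<theta> + s * t)))"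
      by (simp add: m ennreal_power flip: ennreal_mult exp_of_nat_mult exp_add)
    also have "- real n * (s * t) * (x + s * \<delta>) + real n * k (\<theta> + s * t)
        = real n * (k (\<theta> + s * t) - s * t * x - (s * s) * t * \<delta>)"
      by (simp add: algebra_simps)
    also have "\<dots> = real n * (k \<theta> - - g t)"
      by (simp add: g_def s2)
    finally show "(\<integral>\<^sup>+ \<omega>. ennreal (exp (real n * \<theta> * sample_mean T n \<omega>))
            * indicator {y. s * (y - x) \<ge> \<delta>} (sample_mean T n \<omega>) \<partial>M)
          \<le> ennreal (exp (real n * (k \<theta> - - g t)))" .
  qed
qed


text \<open>The integral of \<open>exp (n * \<theta> * Z)\<close> is
  \<open>exp (n * k \<theta>)\<close>, and by \<open>tilted_tail\<close> the part outside the
  \<delta>-neighbourhood of \<open>x\<close> is exponentially smaller. Inside, the integrand is at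
  most \<open>exp (n * (\<theta> * x + \<bar>\<theta>\<bar> * \<delta>))\<close>, so dividing by
  this bounds the probability of \<open>G\<close> from below. The loss
  \<open>\<bar>\<theta>\<bar> * \<delta>\<close> disappears as \<delta> tends to 0.\<close>

lemma cramer_lower_exposed:
  assumes k: "\<And>\<eta>. \<bar>\<eta>\<bar> < e \<Longrightarrow> log_mgf M (T 1) (\<theta> + \<eta>) = ereal (k (\<theta> + \<eta>))" and "0 < e"
    and D: "(k has_real_derivative x) (at \<theta>)" and G: "open G" "x \<in> G"
  shows "ereal (k \<theta> - \<theta> * x)
     \<le> liminf (\<lambda>n. ereal (1 / real n) * ext_ln (emeasure M {\<omega> \<in> space M. sample_mean T n \<omega> \<in> G}))"
    (is "_ \<le> liminf ?p")
proof -
  obtain d where d: "0 < d" "ball x d \<subseteq> G" using G open_contains_ball by blast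
  have lim: "ereal (k \<theta> - \<theta> * x - \<bar>\<theta>\<bar> * \<delta>) \<le> liminf ?p" if \<delta>: "0 < \<delta>" "\<delta> < d" for \<delta>
  proof -
    define c where "c = k \<theta> - \<theta> * x - \<bar>\<theta>\<bar> * \<delta>"
    let ?tail = "\<lambda>s n. \<integral>\<^sup>+ \<omega>. ennreal (exp (real n * \<theta> * sample_mean T n \<omega>))
            * indicator {y. s * (y - x) \<ge> \<delta>} (sample_mean T n \<omega>) \<partial>M"
    obtain \<epsilon>1 where \<epsilon>1: "0 < \<epsilon>1" "\<And>n. 1 \<le> n \<Longrightarrow> ?tail 1 n \<le> ennreal (exp (real n * (k \<theta> - \<epsilon>1)))"
      using tilted_tail[OF k \<open>0 < e\<close> D \<delta>(1), of 1] by auto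
    obtain \<epsilon>2 where \<epsilon>2: "0 < \<epsilon>2" "\<And>n. 1 \<le> n \<Longrightarrow> ?tail (-1) n \<le> ennreal (exp (real n * (k \<theta> - \<epsilon>2)))"
      using tilted_tail[OF k \<open>0 < e\<close> D \<delta>(1), of "-1"] by auto
    define \<epsilon> where "\<epsilon> = min \<epsilon>1 \<epsilon>2"
    have "0 < \<epsilon>" using \<epsilon>1(1) \<epsilon>2(1) by (simp add: \<epsilon>_def)
    have bound: "exp (real n * k \<theta>) \<le> exp (real n * (\<theta> * x + \<bar>\<theta>\<bar> * \<delta>)) * prob {\<omega> \<in> space M. sample_mean T n \<omega> \<in> G}
        + 2 * exp (real n * (k \<theta> - \<epsilon>))" if n: "1 \<le> n" for n
    proof -
      let ?Z = "sample_mean T n"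
      have [measurable]: "G \<in> sets borel" using G(1) by simp
      let ?c = "exp (real n * (\<theta> * x + \<bar>\<theta>\<bar> * \<delta>))"
      have *: "ennreal (exp (real n * \<theta> * y))
          \<le> ennreal ?c * indicator G y
            + ennreal (exp (real n * \<theta> * y)) * indicator {y. 1 * (y - x) \<ge> \<delta>} y
            + ennreal (exp (real n * \<theta> * y)) * indicator {y. -1 * (y - x) \<ge> \<delta>} y" for y
      proof (cases "\<bar>y - x\<bar> < \<delta>")
        case True
        then have "y \<in> G" using d \<delta> by (auto simp: dist_real_def)
        have "\<theta> * (y - x) \<le> \<bar>\<theta>\<bar> * \<bar>y - x\<bar>" by (metis abs_ge_self abs_mult)
        also have "\<dots> \<le> \<bar>\<theta>\<bar> * \<delta>" using True by (intro mult_left_mono) auto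
        finally have "\<theta> * y \<le> \<theta> * x + \<bar>\<theta>\<bar> * \<delta>" by (simp add: algebra_simps)
        then have "real n * (\<theta> * y) \<le> real n * (\<theta> * x + \<bar>\<theta>\<bar> * \<delta>)"
          by (rule mult_left_mono) simp
        then have "ennreal (exp (real n * \<theta> * y)) \<le> ennreal ?c"
          by (intro ennreal_leI) (simp add: mult.assoc)
        then show ?thesis using \<open>y \<in> G\<close> by (simp add: add_increasing2)
      next
        case False
        then have "1 * (y - x) \<ge> \<delta> \<or> -1 * (y - x) \<ge> \<delta>" by auto
        then show ?thesis
          by (auto simp: add_increasing add_increasing2)
      qed
      have "ennreal (exp (real n * k \<theta>)) = mgf \<theta> ^ n"
        using k[of 0] \<open>0 < e\<close> unfolding log_mgf_eq ext_ln_eq_ereal_iff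
        by (simp add: ennreal_power flip: exp_of_nat_mult)
      also have "\<dots> = (\<integral>\<^sup>+ \<omega>. ennreal (exp (real n * \<theta> * ?Z \<omega>)) \<partial>M)"
        using n by (rule mgf_sample_mean[symmetric])
      also have "\<dots> \<le> (\<integral>\<^sup>+ \<omega>. ennreal ?c * indicator G (?Z \<omega>)
            + ennreal (exp (real n * \<theta> * ?Z \<omega>)) * indicator {y. 1 * (y - x) \<ge> \<delta>} (?Z \<omega>)
            + ennreal (exp (real n * \<theta> * ?Z \<omega>)) * indicator {y. -1 * (y - x) \<ge> \<delta>} (?Z \<omega>) \<partial>M)"
        by (intro nn_integral_mono *)
      also have "\<dots> = (\<integral>\<^sup>+ \<omega>. ennreal ?c * indicator G (?Z \<omega>) \<partial>M) + ?tail 1 n + ?tail (-1) n"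
        by (simp add: nn_integral_add)
      also have "(\<integral>\<^sup>+ \<omega>. ennreal ?c * indicator G (?Z \<omega>) \<partial>M)
          = (\<integral>\<^sup>+ \<omega>. ennreal ?c * indicator {\<omega> \<in> space M. ?Z \<omega> \<in> G} \<omega> \<partial>M)"
        by (intro nn_integral_cong) (auto simp: indicator_def)
      also have "\<dots> = ennreal (?c * prob {\<omega> \<in> space M. ?Z \<omega> \<in> G})"
        by (simp add: nn_integral_cmult_indicator emeasure_eq_measure ennreal_mult')
      also have "\<dots> + ?tail 1 n + ?tail (-1) n
          \<le> \<dots> + ennreal (exp (real n * (k \<theta> - \<epsilon>1))) + ennreal (exp (real n * (k \<theta> - \<epsilon>2)))"
        by (intro add_mono order_refl \<epsilon>1(2) \<epsilon>2(2) n)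
      also have "\<dots> \<le> ennreal (?c * prob {\<omega> \<in> space M. ?Z \<omega> \<in> G})
          + ennreal (exp (real n * (k \<theta> - \<epsilon>))) + ennreal (exp (real n * (k \<theta> - \<epsilon>)))"
        by (intro add_mono order_refl ennreal_leI) (simp_all add: \<epsilon>_def mult_left_mono)
      also have "\<dots> = ennreal (?c * prob {\<omega> \<in> space M. ?Z \<omega> \<in> G} + 2 * exp (real n * (k \<theta> - \<epsilon>)))"
        by (simp flip: ennreal_plus)
      finally show ?thesis
        by (subst (asm) ennreal_le_iff) simp_all
    qed
    have "(\<lambda>n. exp (- (\<epsilon> * real n))) \<longlonglongrightarrow> 0"
      using \<open>0 < \<epsilon>\<close> 
      by (intro filterlim_compose[OF exp_at_bot] filterlim_compose[OF filterlim_uminus_at_bot_at_top]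
          filterlim_tendsto_pos_mult_at_top[OF tendsto_const] filterlim_real_sequentially)
    \<comment> \<open>With 1/4 for each of the two tails, at least half of the weighted mass stays
      near \<open>x\<close>.\<close>
    then have "\<forall>\<^sub>F n in sequentially. exp (- (\<epsilon> * real n)) < 1 / 4"
      by (rule order_tendstoD) simp
    then have "\<forall>\<^sub>F n in sequentially. ereal (c - ln 2 / real n) \<le> ?p n"
      using eventually_ge_at_top[of 1]
    proof eventually_elim
      case (elim n)
      let ?q = "prob {\<omega> \<in> space M. sample_mean T n \<omega> \<in> G}"
      have "exp (real n * (k \<theta> - \<epsilon>)) = exp (real n * k \<theta>) * exp (- (\<epsilon> * real n))"
        by (simp add: algebra_simps flip: exp_add)
      also have "\<dots> \<le> exp (real n * k \<theta>) * (1 / 4)"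
        using elim(1) by (intro mult_left_mono) auto
      finally have "exp (real n * k \<theta>) / 2 \<le> exp (real n * (\<theta> * x + \<bar>\<theta>\<bar> * \<delta>)) * ?q"
        using bound[OF elim(2)] by simp
      moreover have "exp (real n * k \<theta>) = exp (real n * (\<theta> * x + \<bar>\<theta>\<bar> * \<delta>)) * exp (real n * c)"
        by (simp add: c_def algebra_simps flip: exp_add)
      ultimately have "exp (real n * c) / 2 \<le> ?q"
        by (simp flip: times_divide_eq_right)
      then have "ext_ln (ennreal (exp (real n * c) / 2)) \<le> ext_ln (emeasure M {\<omega> \<in> space M. sample_mean T n \<omega> \<in> G})"
        by (intro ext_ln_mono) (simp add: emeasure_eq_measure)
      also have "ext_ln (ennreal (exp (real n * c) / 2)) = ereal (real n * c - ln 2)"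
        by (subst ext_ln_ereal) (simp_all add: ln_div)
      finally have "ereal (1 / real n) * ereal (real n * c - ln 2) \<le> ?p n"
        by (rule ereal_mult_left_mono) simp
      then show ?case using elim(2) by (simp add: field_simps)
    qed
    then have "liminf (\<lambda>n. ereal (c - ln 2 / real n)) \<le> liminf ?p"
      by (rule Liminf_mono)
    moreover have "(\<lambda>n. ereal (c - ln 2 / real n)) \<longlonglongrightarrow> ereal (c - 0)"
      by (intro tendsto_intros lim_const_over_n)
    then have "liminf (\<lambda>n. ereal (c - ln 2 / real n)) = ereal (c - 0)"
      by (rule lim_imp_Liminf[OF sequentially_bot])
    ultimately show ?thesis by (simp add: c_def)
  qed
  have "((\<lambda>\<delta>. ereal (k \<theta> - \<theta> * x - \<bar>\<theta>\<bar> * \<delta>)) \<longlongrightarrow> ereal (k \<theta> - \<theta> * x - \<bar>\<theta>\<bar> * 0)) (at_right 0)"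
    by (intro tendsto_intros)
  moreover have "\<forall>\<^sub>F \<delta> in at_right 0. ereal (k \<theta> - \<theta> * x - \<bar>\<theta>\<bar> * \<delta>) \<le> liminf ?p"
    using lim d(1) by (auto intro: eventually_at_rightI[of 0 d])
  ultimately have "ereal (k \<theta> - \<theta> * x - \<bar>\<theta>\<bar> * 0) \<le> liminf ?p"
    by (rule tendsto_upperbound) simp
  then show ?thesis by simp
qed

text \<open>Points of infinite rate do not lower the infimum over \<open>G\<close>, so a tilt is
  demanded only at points of finite rate. There \<open>\<theta> * x - k \<theta>\<close> is one of
  the values whose supremum is the rate, which turns the bound at \<theta> into one by the
  rate.\<close>

theorem cramer_exposed:
  assumes "\<And>x. fenchel_legendre (log_mgf M (T 1)) x < \<infinity> \<Longrightarrow>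
    \<exists>\<theta> e k. 0 < e \<and> (\<forall>\<eta>. \<bar>\<eta>\<bar> < e \<longrightarrow> log_mgf M (T 1) (\<theta> + \<eta>) = ereal (k (\<theta> + \<eta>)))
      \<and> (k has_real_derivative x) (at \<theta>)"
  shows "satisfies_LDP M (sample_mean T) (fenchel_legendre (log_mgf M (T 1)))"
proof -
  let ?I = "fenchel_legendre (log_mgf M (T 1))"
  have "- (INF x\<in>G. ?I x)
      \<le> liminf (\<lambda>n. ereal (1 / real n) * ext_ln (emeasure M {\<omega> \<in> space M. sample_mean T n \<omega> \<in> G}))"
    (is "_ \<le> liminf ?p") if "open G" for G
  proof -
    have "- liminf ?p \<le> ?I x" if "x \<in> G" for x
    proof (cases "?I x < \<infinity>")
      case True
      from assms[OF this] obtain \<theta> e k where k: "0 < e"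
        "\<And>\<eta>. \<bar>\<eta>\<bar> < e \<Longrightarrow> log_mgf M (T 1) (\<theta> + \<eta>) = ereal (k (\<theta> + \<eta>))"
        "(k has_real_derivative x) (at \<theta>)" by blast
      have "ereal (k \<theta> - \<theta> * x) \<le> liminf ?p"
        by (rule cramer_lower_exposed[OF k(2,1,3) \<open>open G\<close> that])
      then have "- liminf ?p \<le> ereal (\<theta> * x) - log_mgf M (T 1) \<theta>"
        using k(2)[of 0] k(1) by (cases "liminf ?p") (simp_all add: algebra_simps)
      also have "\<dots> \<le> ?I x" by (rule fenchel_legendre_upper)
      finally show ?thesis .
    qed simp
    then have "- liminf ?p \<le> (INF x\<in>G. ?I x)" by (intro INF_greatest)
    then show ?thesis by (simp add: ereal_uminus_le_reorder)
  qed
  then show ?thesis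
    unfolding satisfies_LDP_def
    using prob_space_axioms measurable_sample_mean rate_function_fenchel_legendre cramer_upper[OF borel_closed]
    by blast
qed

end

section \<open>Continuation of Laplace transforms\<close>

text \<open>The difference vanishes on an interval ending at its centre, whereas zeros of a nonzero
  power series are isolated. The interval is one-sided because transforms at \<open>p - u\<close>
  are compared for \<open>u \<ge> 0\<close> only.\<close>

lemma powser_eq_coeffs:
  fixes a b :: "nat \<Rightarrow> real"
  assumes "0 < r"
    and "\<And>u. 0 \<le> u \<Longrightarrow> u < r \<Longrightarrow> (\<lambda>n. a n * u ^ n) sums f u"
    and "\<And>u. 0 \<le> u \<Longrightarrow> u < r \<Longrightarrow> (\<lambda>n. b n * u ^ n) sums f u"
  shows "a = b"
proof (rule ccontr)
  assume "a \<noteq> b"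
  then obtain m where m: "a m - b m \<noteq> 0" by (auto simp: fun_eq_iff)
  define c where "c n = a n - b n" for n
  have c: "(\<lambda>n. c n * u ^ n) sums 0" if "0 \<le> u" "u < r" for u
    using sums_diff[OF assms(2,3)[OF that]] by (simp add: c_def algebra_simps)
  have "c 0 = 0" using sums_unique2[OF powser_sums_zero[of c] c[of 0]] \<open>0 < r\<close> by simp
  with m have "m > 0" by (cases m) (auto simp: c_def)
  \<comment> \<open>Convergence at the single point \<open>r / 2\<close> covers negative
    \<open>x\<close> as well.\<close>
  have summ: "(\<lambda>n. c n * (x - 0) ^ n) sums (\<Sum>n. c n * x ^ n)" if "norm (x - 0) < r / 2" for x
    using powser_inside[OF sums_summable[OF c[of "r / 2"]], of x] that \<open>0 < r\<close>
    by (simp add: summable_sums)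
  obtain s where s: "0 < s" "\<And>z. z \<in> cball 0 s - {0} \<Longrightarrow> (\<Sum>n. c n * z ^ n) \<noteq> 0"
    using powser_0_nonzero[of "r / 2" 0 c "\<lambda>x. \<Sum>n. c n * x ^ n" m] summ \<open>0 < r\<close> \<open>c 0 = 0\<close> m \<open>m > 0\<close>
    by (auto simp: c_def)
  define z where "z = min s (r / 2)"
  have "z \<in> cball 0 s - {0}" "0 \<le> z" "z < r" using s(1) \<open>0 < r\<close> by (auto simp: z_def)
  then show False using s(2)[of z] sums_unique[OF c[of z]] by auto
qed

text \<open>\<open>exp (u * t)\<close> is expanded under the integral. For \<open>u \<ge> 0\<close>
  all terms are nonnegative on the support, so sum and integral commute in [0, \<infinity>];
  finiteness of the transform at \<open>p - u\<close> is thus the same as convergence of the moment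
  series at \<open>u\<close>.\<close>

lemma nn_laplace_powser:
  fixes g :: "real \<Rightarrow> ennreal"
  assumes [measurable]: "g \<in> borel_measurable borel"
    and supp: "\<And>t. t < 0 \<Longrightarrow> g t = 0" and "0 \<le> u"
  shows "(\<integral>\<^sup>+ t. g t * ennreal (exp (- (p - u) * t)) \<partial>lborel)
    = (\<Sum>n. (\<integral>\<^sup>+ t. g t * ennreal (t ^ n * exp (- p * t)) \<partial>lborel) * ennreal (u ^ n / fact n))"
proof -
  have "g t * ennreal (exp (- (p - u) * t))
      = (\<Sum>n. g t * ennreal (t ^ n * exp (- p * t)) * ennreal (u ^ n / fact n))" for t
  proof (cases "t < 0")
    case False
    have "(\<lambda>n. (u * t) ^ n / fact n) sums exp (u * t)"
      using exp_converges[of "u * t"] by (simp add: scaleR_conv_of_real field_simps)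
    then have "(\<lambda>n. exp (- p * t) * ((u * t) ^ n / fact n)) sums (exp (- p * t) * exp (u * t))"
      by (rule sums_mult)
    then have "(\<lambda>n. t ^ n * exp (- p * t) * (u ^ n / fact n)) sums exp (- (p - u) * t)"
      by (simp add: algebra_simps flip: exp_add)
    then have "(\<Sum>n. ennreal (t ^ n * exp (- p * t) * (u ^ n / fact n))) = ennreal (exp (- (p - u) * t))"
      using False \<open>0 \<le> u\<close> by (intro suminf_ennreal_eq) auto
    then show ?thesis
      using False \<open>0 \<le> u\<close> by (simp add: mult.assoc flip: ennreal_mult)
  qed (simp add: supp)
  then have "(\<integral>\<^sup>+ t. g t * ennreal (exp (- (p - u) * t)) \<partial>lborel)
     = (\<integral>\<^sup>+ t. (\<Sum>n. g t * ennreal (t ^ n * exp (- p * t)) * ennreal (u ^ n / fact n)) \<partial>lborel)"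
    by simp
  also have "\<dots> = (\<Sum>n. \<integral>\<^sup>+ t. g t * ennreal (t ^ n * exp (- p * t)) * ennreal (u ^ n / fact n) \<partial>lborel)"
    by (rule nn_integral_suminf) simp
  also have "\<dots> = (\<Sum>n. (\<integral>\<^sup>+ t. g t * ennreal (t ^ n * exp (- p * t)) \<partial>lborel) * ennreal (u ^ n / fact n))"
    by (subst nn_integral_multc) simp_all
  finally show ?thesis .
qed

lemma Re_mult_of_real: "Re (z * of_real x) = Re z * x"
  by simp

lemma sums_of_ennreal_suminf:
  fixes m :: "nat \<Rightarrow> real"
  assumes "\<And>n. 0 \<le> m n" and "0 \<le> l" and "(\<Sum>n. ennreal (m n)) = ennreal l"
  shows "m sums l"
  using assms summable_sums[OF summableI, of "\<lambda>n. ennreal (m n)"] by simp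

text \<open>
  The Laplace transform of \<open>f\<close> is known only beyond the abscissa \<open>c\<close>, and \<open>f\<close> is not known to
  be nonnegative. Expanding at a point \<open>p > c\<close>, the coefficients of \<open>F\<close> are the differences of
  the moments of the positive and the negative part of \<open>f\<close>. The moment series of the positive
  part converges up to \<open>0\<close> because its mass is at most \<open>1\<close>, hence so does that of the negative
  part, whose transform turns out to be at most \<open>1 - F s\<close>. Letting \<open>s\<close> tend to \<open>0\<close>, the negative
  part vanishes almost everywhere.
\<close>

lemma laplace_continuation:
  fixes f :: "real \<Rightarrow> real" and F :: "complex \<Rightarrow> complex"
  assumes [measurable]: "f \<in> borel_measurable borel"
    and supp: "\<And>t. t < 0 \<Longrightarrow> f t = 0"
    and mass: "(\<integral>\<^sup>+ t. ennreal (f t) \<partial>lborel) \<le> 1"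
    and holo: "F holomorphic_on {z. 0 < Re z}"
    and conv: "\<And>s. c < s \<Longrightarrow> has_bochner_integral lborel (\<lambda>t. f t * exp (- s * t)) (Re (F (of_real s)))"
    and lim: "((\<lambda>s. Re (F (of_real s))) \<longlongrightarrow> 1) (at_right 0)"
    and "0 < s"
  shows "(\<integral>\<^sup>+ t. ennreal (f t) * ennreal (exp (- s * t)) \<partial>lborel) = ennreal (Re (F (of_real s)))"
proof -
  define LP where "LP s = (\<integral>\<^sup>+ t. ennreal (f t) * ennreal (exp (- s * t)) \<partial>lborel)" for s
  define LN where "LN s = (\<integral>\<^sup>+ t. ennreal (- f t) * ennreal (exp (- s * t)) \<partial>lborel)" for s
  have LP_le: "LP s \<le> 1" if "0 < s" for s
  proof -
    have "LP s \<le> (\<integral>\<^sup>+ t. ennreal (f t) \<partial>lborel)"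
      unfolding LP_def
    proof (intro nn_integral_mono)
      fix t show "ennreal (f t) * ennreal (exp (- s * t)) \<le> ennreal (f t)"
        using that supp[of t] mult_left_mono[of "ennreal (exp (- s * t))" 1 "ennreal (f t)"]
        by (cases "t < 0") auto
    qed
    with mass show ?thesis by (rule order_trans[rotated])
  qed
  have LN_mono: "LN s \<le> LN s'" if "s' \<le> s" for s s'
    unfolding LN_def
  proof (intro nn_integral_mono)
    fix t show "ennreal (- f t) * ennreal (exp (- s * t)) \<le> ennreal (- f t) * ennreal (exp (- s' * t))"
      using that supp[of t]
      by (cases "t < 0") (auto intro!: mult_left_mono ennreal_leI mult_right_mono)
  qed
  have L_fin: "LP s < \<top>" "LN s < \<top>" "Re (F (of_real s)) = enn2real (LP s) - enn2real (LN s)"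
    if "c < s" for s
  proof -
    have I: "integrable lborel (\<lambda>t. f t * exp (- s * t))"
      and E: "Re (F (of_real s)) = (\<integral>t. f t * exp (- s * t) \<partial>lborel)"
      using conv[OF that] by (auto simp: has_bochner_integral_iff)
    have LP: "LP s = (\<integral>\<^sup>+ t. ennreal (f t * exp (- s * t)) \<partial>lborel)"
      unfolding LP_def by (simp add: ennreal_mult'')
    have LN: "LN s = (\<integral>\<^sup>+ t. ennreal (- (f t * exp (- s * t))) \<partial>lborel)"
      unfolding LN_def mult_minus_left[symmetric] by (simp only: ennreal_mult'' exp_ge_zero)
    from I show "LP s < \<top>" "LN s < \<top>"
      unfolding LP LN real_integrable_def by (auto simp: top.not_eq_extremum)
    show "Re (F (of_real s)) = enn2real (LP s) - enn2real (LN s)"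
      unfolding E LP LN by (rule real_lebesgue_integral_def[OF I])
  qed
  have key: "LN s = ennreal (enn2real (LP s) - Re (F (of_real s)))
      \<and> 0 \<le> enn2real (LP s) - Re (F (of_real s))" if "0 < s" for s
  proof -
    \<comment> \<open>The centre lies beyond \<open>c\<close>, where the transform is known, and to
      the right of \<open>s\<close>, so that \<open>s\<close> is reached with the nonnegative
      increment \<open>p - s\<close>.\<close>
    define p where "p = max c s + 1"
    have p: "c < p" "s < p" "0 < p" using that by (auto simp: p_def)
    define MP where "MP n = (\<integral>\<^sup>+ t. ennreal (f t) * ennreal (t ^ n * exp (- p * t)) \<partial>lborel)" for n
    define MN where "MN n = (\<integral>\<^sup>+ t. ennreal (- f t) * ennreal (t ^ n * exp (- p * t)) \<partial>lborel)" for n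
    have LP_sum: "LP (p - u) = (\<Sum>n. MP n * ennreal (u ^ n / fact n))" if "0 \<le> u" for u
      unfolding LP_def MP_def by (rule nn_laplace_powser) (use that supp in auto)
    have LN_sum: "LN (p - u) = (\<Sum>n. MN n * ennreal (u ^ n / fact n))" if "0 \<le> u" for u
      unfolding LN_def MN_def by (rule nn_laplace_powser) (use that supp in auto)
    define r where "r = p - c"
    have "0 < r" using p by (simp add: r_def)
    \<comment> \<open>At \<open>u = r / 2\<close> the point \<open>p - u\<close> is still beyond
      \<open>c\<close>; one finite sum of nonnegative terms makes every moment finite.\<close>
    have fin: "M n < \<top>" if "(\<Sum>n. M n * ennreal ((r / 2) ^ n / fact n)) < \<top>" for M :: "nat \<Rightarrow> ennreal" and n
      using ennreal_suminf_lessD[OF that, of n] \<open>0 < r\<close> by (auto simp: ennreal_mult_less_top)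
    have "c < p - r / 2" using p by (simp add: r_def field_simps)
    have MP_fin: "MP n < \<top>" and MN_fin: "MN n < \<top>" for n
      using fin[of MP n] fin[of MN n] LP_sum[of "r / 2"] LN_sum[of "r / 2"] L_fin(1,2)[OF \<open>c < p - r / 2\<close>] \<open>0 < r\<close>
      by simp_all
    define mP where "mP n = enn2real (MP n)" for n
    define mN where "mN n = enn2real (MN n)" for n
    have MP: "MP n = ennreal (mP n)" and MN: "MN n = ennreal (mN n)" for n
      using MP_fin MN_fin by (simp_all add: mP_def mN_def)
    have nonneg: "0 \<le> mP n" "0 \<le> mN n" for n by (simp_all add: mP_def mN_def)
    have P_sums: "(\<lambda>n. mP n / fact n * u ^ n) sums enn2real (LP (p - u))"
      if "0 \<le> u" "LP (p - u) < \<top>" for u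
      using that LP_sum[of u] nonneg
      by (intro sums_of_ennreal_suminf) (simp_all add: MP flip: ennreal_mult)
    have N_sums: "(\<lambda>n. mN n / fact n * u ^ n) sums enn2real (LN (p - u))"
      if "0 \<le> u" "LN (p - u) < \<top>" for u
      using that LN_sum[of u] nonneg
      by (intro sums_of_ennreal_suminf) (simp_all add: MN flip: ennreal_mult)
    \<comment> \<open>Taylor coefficients of \<open>F\<close> at \<open>p\<close> in the variable
      \<open>u = p - z\<close>, whence the sign. The disc of radius \<open>p\<close> lies in the
      half plane, so the series represents \<open>F\<close> down to 0.\<close>
    define a where "a n = Re ((deriv ^^ n) F (of_real p) / fact n) * (-1) ^ n" for n
    have a_sums: "(\<lambda>n. a n * u ^ n) sums Re (F (of_real (p - u)))" if "0 \<le> u" "u < p" for u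
    proof -
      have "F holomorphic_on ball (of_real p) p"
      proof (rule holomorphic_on_subset[OF holo], safe)
        fix z assume "z \<in> ball (complex_of_real p) p"
        then have "\<bar>Re (of_real p - z)\<bar> < p"
          using abs_Re_le_cmod[of "of_real p - z"] by (simp add: dist_norm)
        then show "0 < Re z" by simp
      qed
      from holomorphic_power_series[OF this, of "of_real (p - u)"]
      have "(\<lambda>n. (deriv ^^ n) F (of_real p) / fact n * (of_real (p - u) - of_real p) ^ n) sums F (of_real (p - u))"
        using that by (simp add: dist_norm)
      from sums_Re[OF this]
      have "(\<lambda>n. Re ((deriv ^^ n) F (of_real p) / fact n * of_real ((- u) ^ n))) sums Re (F (of_real (p - u)))"
        by simp
      moreover have "Re ((deriv ^^ n) F (of_real p) / fact n * of_real ((- u) ^ n)) = a n * u ^ n" for n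
        unfolding a_def power_minus[of u] Re_mult_of_real by (simp only: mult.assoc)
      ultimately show ?thesis by simp
    qed
    have a_eq: "a = (\<lambda>n. mP n / fact n - mN n / fact n)"
    proof (rule powser_eq_coeffs[of "min p r"])
      show "0 < min p r" using p \<open>0 < r\<close> by simp
      fix u assume u: "0 \<le> u" "u < min p r"
      then show "(\<lambda>n. a n * u ^ n) sums Re (F (of_real (p - u)))" using a_sums by simp
      have "c < p - u" using u by (simp add: r_def)
      then show "(\<lambda>n. (mP n / fact n - mN n / fact n) * u ^ n) sums Re (F (of_real (p - u)))"
        using sums_diff[OF P_sums[of u] N_sums[of u]] u L_fin[of "p - u"]
        by (simp add: left_diff_distrib)
    qed
    have "LP (p - (p - s)) < \<top>" using LP_le[OF \<open>0 < s\<close>] by (simp add: le_less_trans)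
    from sums_diff[OF P_sums[OF _ this] a_sums[of "p - s"]]
    have "(\<lambda>n. mN n / fact n * (p - s) ^ n) sums (enn2real (LP s) - Re (F (of_real s)))"
      using p \<open>0 < s\<close> by (simp add: a_eq left_diff_distrib)
    moreover from sums_le[OF _ sums_zero this] have le: "0 \<le> enn2real (LP s) - Re (F (of_real s))"
      using nonneg p by simp
    moreover have nn: "0 \<le> mN n / fact n * (p - s) ^ n" for n using nonneg p by simp
    ultimately have "(\<Sum>n. ennreal (mN n / fact n * (p - s) ^ n)) = ennreal (enn2real (LP s) - Re (F (of_real s)))"
      by (intro suminf_ennreal_eq)
    moreover have "LN (p - (p - s)) = (\<Sum>n. ennreal (mN n / fact n * (p - s) ^ n))"
      using p nonneg by (subst LN_sum) (simp_all add: MN flip: ennreal_mult)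
    ultimately show ?thesis using le by simp
  qed
  have "LN s \<le> ennreal (1 - Re (F (of_real s')))" if "0 < s'" "s' < s" for s'
  proof -
    have "LN s \<le> LN s'" using that by (intro LN_mono) simp
    also have "\<dots> \<le> ennreal (1 - Re (F (of_real s')))"
      using key[OF that(1)] enn2real_mono[OF LP_le[OF that(1)]] by (auto intro!: ennreal_leI)
    finally show ?thesis .
  qed
  then have "\<forall>\<^sub>F s' in at_right 0. LN s \<le> ennreal (1 - Re (F (of_real s')))"
    using \<open>0 < s\<close> by (auto intro!: eventually_at_rightI[of 0 s])
  moreover have "((\<lambda>s'. ennreal (1 - Re (F (of_real s')))) \<longlongrightarrow> ennreal (1 - 1)) (at_right 0)"
    by (intro tendsto_ennrealI tendsto_intros lim)
  ultimately have "LN s \<le> 0"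
    using tendsto_lowerbound[of "\<lambda>s'. ennreal (1 - Re (F (of_real s')))" "ennreal (1 - 1)" "at_right 0" "LN s"]
    by simp
  then have "enn2real (LP s) = Re (F (of_real s))"
    using key[OF \<open>0 < s\<close>] by (simp add: ennreal_eq_0_iff)
  moreover have "LP s < \<top>" using LP_le[OF \<open>0 < s\<close>] by (simp add: le_less_trans)
  ultimately have "LP s = ennreal (Re (F (of_real s)))" by (metis ennreal_enn2real)
  then show ?thesis unfolding LP_def .
qed

section \<open>The Mittag-Leffler density\<close>

lemma nn_integral_powr_exp:
  fixes a s :: real
  assumes "0 < a" and "0 < s"
  shows "(\<integral>\<^sup>+ t. ennreal (indicator {0<..} t * t powr (a - 1) * exp (- s * t)) \<partial>lborel)
    = ennreal (Gamma a / s powr a)"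
proof -
  have "ennreal (Gamma a) = (\<integral>\<^sup>+ t. ennreal (indicator {0..} t * t powr (a - 1) / exp t) \<partial>lborel)"
    using \<open>0 < a\<close> by (rule Gamma_conv_nn_integral_real)
  also have "\<dots> = ennreal \<bar>s\<bar> * (\<integral>\<^sup>+ t. ennreal (indicator {0..} (0 + s * t) * (0 + s * t) powr (a - 1) / exp (0 + s * t)) \<partial>lborel)"
    using \<open>0 < s\<close> by (intro nn_integral_real_affine) simp_all
  \<comment> \<open>The indicators differ at \<open>t = 0\<close>, where both integrands vanish
    since \<open>0 powr (a - 1) = 0\<close>.\<close>
  also have "\<dots> = (\<integral>\<^sup>+ t. ennreal (s powr a) * ennreal (indicator {0<..} t * t powr (a - 1) * exp (- s * t)) \<partial>lborel)"
    using \<open>0 < s\<close>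
    apply (subst nn_integral_cmult[symmetric])
     apply simp
    apply (intro nn_integral_cong)
    subgoal for t
      by (cases "t > 0"; cases "t = 0")
        (simp_all add: indicator_def powr_mult powr_diff exp_minus field_simps zero_le_mult_iff flip: ennreal_mult)
    done
  also have "\<dots> = ennreal (s powr a) * (\<integral>\<^sup>+ t. ennreal (indicator {0<..} t * t powr (a - 1) * exp (- s * t)) \<partial>lborel)"
    by (rule nn_integral_cmult) simp
  finally have "ennreal (1 / s powr a) * ennreal (Gamma a)
     = ennreal (1 / s powr a) * ennreal (s powr a) * (\<integral>\<^sup>+ t. ennreal (indicator {0<..} t * t powr (a - 1) * exp (- s * t)) \<partial>lborel)"
    by (simp add: mult.assoc)
  then show ?thesis
    using \<open>0 < s\<close> \<open>0 < a\<close> by (simp flip: ennreal_mult)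
qed

lemma has_bochner_integral_powr_exp:
  fixes a s :: real
  assumes "0 < a" and "0 < s"
  shows "has_bochner_integral lborel (\<lambda>t. indicator {0<..} t * t powr (a - 1) * exp (- s * t)) (Gamma a / s powr a)"
  using assms nn_integral_powr_exp[OF assms]
  by (intro has_bochner_integral_nn_integral) (auto intro!: mult_nonneg_nonneg)

lemma binomial_series_pochhammer:
  fixes h z :: real
  assumes "\<bar>z\<bar> < 1"
  shows "(\<lambda>r. pochhammer h r / fact r * z ^ r) sums (1 - z) powr (- h)"
proof -
  have "(- h gchoose r) * (- z) ^ r = pochhammer h r / fact r * z ^ r" for r
    by (simp add: gbinomial_pochhammer flip: power_mult_distrib)
  with gen_binomial_real[of "- z" "- h"] assms show ?thesis by simp
qed

lemma borel_measurable_ml_density [measurable]: "ml_density \<nu> h lam \<in> borel_measurable borel"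
  unfolding ml_density_def[abs_def] mittag_leffler_def by measurable

text \<open>The Gamma integral of each term cancels the Gamma factor of its coefficient and leaves a
  binomial series at \<open>- y\<close> with \<open>y = lam * s powr (- \<nu>)\<close>. Taking
  absolute values replaces \<open>- y\<close> by \<open>y\<close>, so \<open>small\<close> is the
  condition for absolute convergence.\<close>

lemma laplace_ml_density:
  assumes "0 < \<nu>" "0 < h" "0 < lam" "0 < s" and small: "lam * s powr (- \<nu>) < 1"
  shows "has_bochner_integral lborel (\<lambda>t. ml_density \<nu> h lam t * exp (- s * t)) ((lam / (lam + s powr \<nu>)) powr h)"
proof -
  define c where "c r = lam powr h * lam ^ r * pochhammer h r / (fact r * Gamma (\<nu> * real r + \<nu> * h))" for r
  define e where "e r t = indicator {0<..} t * t powr (\<nu> * real r + \<nu> * h - 1) * exp (- s * t)" for r and t :: real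
  have pos: "0 < \<nu> * real r + \<nu> * h" for r
    using assms by (simp add: add_nonneg_pos)
  have poch: "0 < pochhammer h r" for r using \<open>0 < h\<close> by (rule pochhammer_pos)
  have c: "0 \<le> c r" for r
    using Gamma_real_pos[OF pos[of r]] poch[of r] \<open>0 < lam\<close> by (simp add: c_def)
  have e: "has_bochner_integral lborel (e r) (Gamma (\<nu> * real r + \<nu> * h) / s powr (\<nu> * real r + \<nu> * h))" for r
    unfolding e_def using pos \<open>0 < s\<close> by (rule has_bochner_integral_powr_exp)
  have e_nonneg: "0 \<le> e r t" for r t by (simp add: e_def)
  define y where "y = lam * s powr (- \<nu>)"
  have y: "0 < y" "y < 1" using small \<open>0 < lam\<close> \<open>0 < s\<close> by (simp_all add: y_def)
  have val: "c r * (Gamma (\<nu> * real r + \<nu> * h) / s powr (\<nu> * real r + \<nu> * h))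
      = y powr h * (pochhammer h r / fact r * y ^ r)" for r
  proof -
    have "lam ^ r = y ^ r * s powr (\<nu> * real r)"
      using \<open>0 < s\<close> by (simp add: y_def powr_minus powr_powr field_simps flip: powr_realpow)
    moreover have "lam powr h = y powr h * s powr (\<nu> * h)"
      using \<open>0 < s\<close> \<open>0 < lam\<close> by (simp add: y_def powr_mult powr_powr flip: powr_add)
    moreover have "Gamma (\<nu> * real r + \<nu> * h) > 0" using pos by (rule Gamma_real_pos)
    ultimately show ?thesis
      using \<open>0 < s\<close> by (simp add: c_def powr_add)
  qed
  have abs_sums: "(\<lambda>r. y powr h * (pochhammer h r / fact r * y ^ r)) sums (y powr h * (1 - y) powr (- h))"
    using y by (intro sums_mult binomial_series_pochhammer) simp
  have alt_sums: "(\<lambda>r. (-1) ^ r * (y powr h * (pochhammer h r / fact r * y ^ r))) sums (y powr h * (1 + y) powr (- h))"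
    using sums_mult[OF binomial_series_pochhammer[of "- y" h], of "y powr h"] y
    by (simp add: power_minus[of y] mult_ac)
  have norm_term: "norm ((-1) ^ r * c r * e r t) = c r * e r t" for r t
    using c[of r] e_nonneg[of r t] by (simp add: abs_mult power_abs)
  have int_e: "integrable lborel (e r)" "(\<integral>t. e r t \<partial>lborel) = Gamma (\<nu> * real r + \<nu> * h) / s powr (\<nu> * real r + \<nu> * h)" for r
    using e[of r] by (auto simp: has_bochner_integral_iff)
  have [measurable]: "e r \<in> borel_measurable lborel" for r using int_e(1)[of r] by auto
  \<comment> \<open>Convergence of the Mittag-Leffler series is itself a consequence of Tonelli: the
    absolute values have a finite integral, hence a finite sum for almost every
    \<open>t\<close>.\<close>
  have AE: "AE t in lborel. summable (\<lambda>r. norm ((-1) ^ r * c r * e r t))"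
  proof -
    have "(\<integral>\<^sup>+ t. (\<Sum>r. ennreal (c r * e r t)) \<partial>lborel) = (\<Sum>r. \<integral>\<^sup>+ t. ennreal (c r * e r t) \<partial>lborel)"
      by (rule nn_integral_suminf) simp
    also have "\<dots> = (\<Sum>r. ennreal (y powr h * (pochhammer h r / fact r * y ^ r)))"
    proof (intro arg_cong[where f = suminf] ext)
      fix r
      have "(\<integral>\<^sup>+ t. ennreal (c r * e r t) \<partial>lborel) = ennreal (\<integral>t. c r * e r t \<partial>lborel)"
        using c e_nonneg int_e by (intro nn_integral_eq_integral) auto
      then show "(\<integral>\<^sup>+ t. ennreal (c r * e r t) \<partial>lborel) = ennreal (y powr h * (pochhammer h r / fact r * y ^ r))"
        by (simp only: integral_mult_right_zero int_e(2) val)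
    qed
    also have "\<dots> \<noteq> \<infinity>"
      using poch y sums_summable[OF abs_sums]
      by (simp only: infinity_ennreal_def) (intro ennreal_suminf_neq_top, auto intro!: mult_nonneg_nonneg divide_nonneg_nonneg less_imp_le)
    finally have "AE t in lborel. (\<Sum>r. ennreal (c r * e r t)) \<noteq> \<infinity>"
      by (intro nn_integral_PInf_AE) auto
    then show ?thesis
    proof eventually_elim
      case (elim t)
      then show ?case unfolding norm_term
        using c e_nonneg by (intro summable_suminf_not_top) auto
    qed
  qed
  have summ: "summable (\<lambda>r. \<integral>t. norm ((-1) ^ r * c r * e r t) \<partial>lborel)"
    unfolding norm_term integral_mult_right_zero int_e(2) val by (rule sums_summable[OF abs_sums])
  \<comment> \<open>Pulling a factor out of \<open>suminf\<close> requires summability, so the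
    identity is claimed only at those \<open>t\<close> where it is known.\<close>
  have ml: "(\<Sum>r. (-1) ^ r * c r * e r t) = ml_density \<nu> h lam t * exp (- s * t)"
    if s: "summable (\<lambda>r. norm ((-1) ^ r * c r * e r t))" for t
  proof (cases "0 < t")
    case True
    define d where "d = lam powr h * t powr (\<nu> * h - 1) * exp (- s * t)"
    have "0 < d" using \<open>0 < lam\<close> True by (simp add: d_def)
    let ?m = "\<lambda>r. pochhammer h r * (- lam * t powr \<nu>) ^ r / (fact r * Gamma (\<nu> * real r + \<nu> * h))"
    have "(-1) ^ r * c r * e r t = d * ?m r" for r
    proof -
      have "t powr (\<nu> * real r + \<nu> * h - 1) = (t powr \<nu>) ^ r * t powr (\<nu> * h - 1)"
        using True by (simp add: powr_powr powr_add[symmetric] add_diff_eq flip: powr_realpow)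
      moreover have "(- lam * t powr \<nu>) ^ r = (-1) ^ r * lam ^ r * (t powr \<nu>) ^ r"
        by (metis mult_minus1 power_mult_distrib)
      ultimately show ?thesis
        using True by (simp add: c_def e_def d_def)
    qed
    moreover have "summable (\<lambda>r. (-1) ^ r * c r * e r t)" using s by (rule summable_norm_cancel)
    ultimately have "summable (\<lambda>r. d * ?m r)" by simp
    then have "summable ?m" using \<open>0 < d\<close> by (subst (asm) summable_cmult_iff) auto
    then have "(\<Sum>r. d * ?m r) = d * mittag_leffler \<nu> (\<nu> * h) h (- lam * t powr \<nu>)"
      unfolding mittag_leffler_def by (rule suminf_mult)
    then show ?thesis
      using True \<open>\<And>r. (-1) ^ r * c r * e r t = d * ?m r\<close>
      by (simp add: ml_density_def d_def)
  qed (simp add: e_def ml_density_def)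
  have int: "integrable lborel (\<lambda>t. \<Sum>r. (-1) ^ r * c r * e r t)"
    and sums: "(\<lambda>r. \<integral>t. (-1) ^ r * c r * e r t \<partial>lborel) sums (\<integral>t. (\<Sum>r. (-1) ^ r * c r * e r t) \<partial>lborel)"
    using int_e(1) by (intro integrable_suminf[OF _ AE summ] sums_integral[OF _ AE summ]; simp)+
  have AE_eq: "AE t in lborel. (\<Sum>r. (-1) ^ r * c r * e r t) = ml_density \<nu> h lam t * exp (- s * t)"
    using AE by eventually_elim (rule ml)
  have "(\<integral>t. (\<Sum>r. (-1) ^ r * c r * e r t) \<partial>lborel) = y powr h * (1 + y) powr (- h)"
    by (rule sums_unique2[OF sums]) (simp only: mult.assoc integral_mult_right_zero int_e(2) val alt_sums)
  also have "\<dots> = (lam / (lam + s powr \<nu>)) powr h"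
  proof -
    have "y / (1 + y) = lam / (lam + s powr \<nu>)"
      using \<open>0 < s\<close> \<open>0 < lam\<close> by (simp add: y_def powr_minus field_simps)
    then show ?thesis using y by (simp add: powr_minus_divide flip: powr_divide)
  qed
  finally have "has_bochner_integral lborel (\<lambda>t. \<Sum>r. (-1) ^ r * c r * e r t) ((lam / (lam + s powr \<nu>)) powr h)"
    using int by (simp add: has_bochner_integral_iff)
  moreover have "has_bochner_integral lborel (\<lambda>t. \<Sum>r. (-1) ^ r * c r * e r t) ((lam / (lam + s powr \<nu>)) powr h)
      \<longleftrightarrow> has_bochner_integral lborel (\<lambda>t. ml_density \<nu> h lam t * exp (- s * t)) ((lam / (lam + s powr \<nu>)) powr h)"
    using int AE_eq by (intro has_bochner_integral_cong_AE) auto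
  ultimately show ?thesis by blast
qed

text \<open>\<open>pochhammer h r\<close> is the quotient of \<open>Gamma (h + r)\<close> and
  \<open>Gamma h\<close>; the numerator cancels and the exponential series remains, which gives the
  Gamma density.\<close>

lemma ml_density_1:
  assumes "0 < h" and "0 < lam"
  shows "ml_density 1 h lam t = lam powr h / Gamma h * (indicator {0<..} t * t powr (h - 1) * exp (- lam * t))"
proof (cases "0 < t")
  case True
  have "pochhammer h r * (- lam * t powr 1) ^ r / (fact r * Gamma (1 * real r + 1 * h)) = (- lam * t) ^ r /\<^sub>R fact r / Gamma h" for r
  proof -
    have "pochhammer h r = Gamma (h + real r) / Gamma h"
      using \<open>0 < h\<close> by (intro pochhammer_Gamma) auto
    moreover have "Gamma (h + real r) > 0" using \<open>0 < h\<close> by (intro Gamma_real_pos) auto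
    ultimately show ?thesis using True by (simp add: field_simps scaleR_conv_of_real)
  qed
  moreover have "(\<lambda>r. (- lam * t) ^ r /\<^sub>R fact r / Gamma h) sums (exp (- lam * t) / Gamma h)"
    by (intro sums_divide exp_converges)
  ultimately have "mittag_leffler 1 (1 * h) h (- lam * t powr 1) = exp (- lam * t) / Gamma h"
    unfolding mittag_leffler_def by (simp add: sums_iff)
  then show ?thesis unfolding ml_density_def using True by simp
qed (simp add: ml_density_def)

text \<open>\<open>F\<close> extends \<open>(1 + s powr \<nu> / lam) powr (- h)\<close>. For \<nu>
  at most 1 the argument of \<open>z powr \<nu>\<close> stays below \<open>pi / 2\<close> in
  absolute value, so the argument of \<open>Ln\<close> has positive real part and avoids the branch
  cut.\<close>

lemma ml_laplace_holomorphic: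
  fixes \<nu> h lam s :: real
  assumes "0 < \<nu>" "\<nu> \<le> 1" "0 < lam"
  defines "F \<equiv> \<lambda>z. exp (- of_real h * Ln (1 + z powr of_real \<nu> / of_real lam))"
  shows "F holomorphic_on {z. 0 < Re z}"
    and "0 < s \<Longrightarrow> Re (F (of_real s)) = (lam / (lam + s powr \<nu>)) powr h"
proof -
  have "0 < Re (z powr of_real \<nu>)" if "0 < Re z" for z
  proof -
    have "\<bar>Im (Ln z)\<bar> < pi / 2" using that by (rule Re_Ln_pos_lt_imp)
    then have "\<bar>\<nu> * Im (Ln z)\<bar> < pi / 2"
      using assms mult_left_le_one_le[of "\<bar>Im (Ln z)\<bar>" \<nu>] by (simp add: abs_mult)
    then have "0 < cos (\<nu> * Im (Ln z))" by (intro cos_gt_zero_pi) auto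
    moreover have "z \<noteq> 0" using that by auto
    ultimately show ?thesis by (simp add: powr_def Re_exp)
  qed
  then have "0 < Re (1 + z powr of_real \<nu> / of_real lam)" if "0 < Re z" for z
    using that \<open>0 < lam\<close> by (simp add: add_pos_pos)
  then have "1 + z powr of_real \<nu> / of_real lam \<notin> \<real>\<^sub>\<le>\<^sub>0" if "0 < Re z" for z
    using that by (metis complex_nonpos_Reals_iff not_le)
  then show "F holomorphic_on {z. 0 < Re z}"
    unfolding F_def using \<open>0 < lam\<close>
    by (intro holomorphic_intros) (auto simp: complex_nonpos_Reals_iff)
  assume "0 < s"
  have "0 < 1 + s powr \<nu> / lam" using \<open>0 < lam\<close> by (simp add: add_pos_nonneg)
  have "1 + of_real s powr of_real \<nu> / of_real lam = complex_of_real (1 + s powr \<nu> / lam)"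
    using \<open>0 < s\<close> by (simp add: powr_of_real)
  then have "F (of_real s) = exp (- of_real h * of_real (ln (1 + s powr \<nu> / lam)))"
    unfolding F_def using Ln_of_real[OF \<open>0 < 1 + s powr \<nu> / lam\<close>] by presburger
  then have "F (of_real s) = of_real (exp (- h * ln (1 + s powr \<nu> / lam)))"
    by (simp only: of_real_mult[symmetric] of_real_minus[symmetric] exp_of_real)
  moreover have "exp (- h * ln (1 + s powr \<nu> / lam)) = (1 / (1 + s powr \<nu> / lam)) powr h"
    using \<open>0 < 1 + s powr \<nu> / lam\<close> by (simp add: powr_def ln_div)
  moreover have "1 / (1 + s powr \<nu> / lam) = lam / (lam + s powr \<nu>)"
    using \<open>0 < lam\<close> by (simp add: field_simps)
  ultimately show "Re (F (of_real s)) = (lam / (lam + s powr \<nu>)) powr h" by simp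
qed

section \<open>The rate functions\<close>

lemma fenchel_legendre_le:
  assumes "\<And>\<theta> r. \<kappa> \<theta> = ereal r \<Longrightarrow> \<theta> * x - r \<le> b" and "\<And>\<theta>. \<kappa> \<theta> \<noteq> -\<infinity>"
  shows "fenchel_legendre \<kappa> x \<le> ereal b"
  unfolding fenchel_legendre_def
proof (rule SUP_least)
  fix \<theta> show "ereal (\<theta> * x) - \<kappa> \<theta> \<le> ereal b"
    using assms(1)[of \<theta>] assms(2)[of \<theta>] by (cases "\<kappa> \<theta>") auto
qed

lemma closed_sublevel_of_lower_semicontinuous:
  assumes "lower_semicontinuous I"
  shows "closed {x. I x \<le> c}"
proof -
  have "open {x. c < I x}"
  proof (subst open_subopen, rule ballI)
    fix x assume "x \<in> {x. c < I x}"
    then have "\<forall>\<^sub>F y in nhds x. c < I y" using assms by (simp add: lower_semicontinuous_def)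
    then show "\<exists>T. open T \<and> x \<in> T \<and> T \<subseteq> {x. c < I x}"
      unfolding eventually_nhds by blast
  qed
  moreover have "{x. I x \<le> c} = - {x. c < I x}" by auto
  ultimately show ?thesis by (simp add: closed_def)
qed

lemma at_right_limit_of_lower_semicontinuous:
  fixes I :: "real \<Rightarrow> ereal"
  assumes "lower_semicontinuous I" and "I a = \<infinity>"
  shows "(I \<longlongrightarrow> \<infinity>) (at_right a)"
  unfolding tendsto_PInfty
proof
  fix r :: real
  have "\<forall>\<^sub>F y in nhds a. ereal r < I y"
    using assms unfolding lower_semicontinuous_def by (metis ereal_infty_less(1) PInfty_neq_ereal(1))
  then show "\<forall>\<^sub>F y in at_right a. ereal r < I y" by (rule filter_leD[OF at_within_le_nhds])
qed

text \<open>The Laplace exponent, that is, minus the cumulant function at \<open>- s\<close>. It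
  vanishes at 0 because \<open>0 powr \<nu> = 0\<close>.\<close>

definition ml_exponent :: "real \<Rightarrow> real \<Rightarrow> real \<Rightarrow> real \<Rightarrow> real" where
  "ml_exponent \<nu> h lam s = h * ln (1 + s powr \<nu> / lam)"

section \<open>Legendre transform of the Mittag-Leffler cumulant function, \<nu> < 1\<close>

context
  fixes \<nu> h lam :: real and \<kappa> :: "real \<Rightarrow> ereal"
  assumes par: "0 < \<nu>" "\<nu> < 1" "0 < h" "0 < lam"
    and \<kappa>: "\<And>\<theta>. \<kappa> \<theta> = (if \<theta> \<le> 0 then ereal (- ml_exponent \<nu> h lam (- \<theta>)) else \<infinity>)"
begin

lemma ml_rate_le:
  assumes "\<And>s. 0 \<le> s \<Longrightarrow> ml_exponent \<nu> h lam s - s * x \<le> b"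
  shows "fenchel_legendre \<kappa> x \<le> ereal b"
proof (rule fenchel_legendre_le)
  fix \<theta> r assume "\<kappa> \<theta> = ereal r"
  then have "\<theta> \<le> 0" "r = - ml_exponent \<nu> h lam (- \<theta>)" by (auto simp: \<kappa> split: if_splits)
  with assms[of "- \<theta>"] show "\<theta> * x - r \<le> b" by simp
qed (simp add: \<kappa>)

lemma ml_rate_ge:
  "0 \<le> s \<Longrightarrow> ereal (ml_exponent \<nu> h lam s - s * x) \<le> fenchel_legendre \<kappa> x"
  using fenchel_legendre_upper[of "- s" x \<kappa>] by (simp add: \<kappa>)

text \<open>\<open>g\<close> vanishes at 0, has infinite slope there since \<nu> < 1, and tends to
  minus infinity because the exponent grows only logarithmically. Its maximum is therefore positive
  and attained at some \<open>s > 0\<close>, where the derivative of the exponent must equal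
  \<open>x\<close>.\<close>

lemma ml_rate_attained:
  assumes "0 < x"
  obtains s where "0 < s" "fenchel_legendre \<kappa> x = ereal (ml_exponent \<nu> h lam s - s * x)"
    "(ml_exponent \<nu> h lam has_real_derivative x) (at s)"
proof -
  define g where "g s = ml_exponent \<nu> h lam s - s * x" for s
  have "g 0 = 0" by (simp add: g_def ml_exponent_def)
  have "filterlim g at_bot at_top"
    unfolding g_def ml_exponent_def using par \<open>0 < x\<close> by real_asymp
  then obtain R where R: "\<And>s. R \<le> s \<Longrightarrow> g s \<le> 0"
    unfolding filterlim_at_bot eventually_at_top_linorder by blast
  have "filterlim (\<lambda>s. g s / s) at_top (at_right 0)"
    unfolding g_def ml_exponent_def using par \<open>0 < x\<close> by real_asymp
  then have "\<forall>\<^sub>F s in at_right 0. 1 \<le> g s / s \<and> 0 < s"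
    by (intro eventually_conj eventually_at_right_less) (simp add: filterlim_at_top)
  then obtain s1 where "1 \<le> g s1 / s1" "0 < s1"
    using eventually_happens' trivial_limit_at_right_real by blast
  then have s1: "0 < s1" "0 < g s1" by (simp_all add: field_simps)
  \<comment> \<open>The interval must contain \<open>s1\<close>, so that the maximum on it is
    positive and exceeds every value beyond \<open>R\<close>.\<close>
  define R' where "R' = max R s1"
  have dnz: "1 + s powr \<nu> / lam > 0" for s using par by (simp add: add_pos_nonneg)
  have "continuous_on {0..R'} (\<lambda>s. s powr \<nu>)"
    using par by (intro continuous_on_powr' continuous_intros) auto
  then have "continuous_on {0..R'} g"
    unfolding g_def ml_exponent_def using par dnz
    by (intro continuous_on_diff continuous_on_mult continuous_on_ln continuous_on_add
        continuous_on_divide continuous_on_const continuous_on_id) (auto simp: less_imp_neq[symmetric])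
  then obtain s where s: "s \<in> {0..R'}" "\<And>t. t \<in> {0..R'} \<Longrightarrow> g t \<le> g s"
    using continuous_attains_sup[of "{0..R'}" g] s1 unfolding R'_def
    by (metis atLeastAtMost_iff compact_Icc empty_iff less_imp_le max.cobounded2)
  have "0 < g s" using s(2)[of s1] s1 by (simp add: R'_def)
  then have "0 < s" using s(1) \<open>g 0 = 0\<close> by (cases "s = 0") auto
  have max: "g t \<le> g s" if "0 \<le> t" for t
  proof (cases "t \<le> R'")
    case False
    then have "R \<le> t" by (simp add: R'_def)
    then show ?thesis using R[of t] \<open>0 < g s\<close> by linarith
  qed (use s(2) that in simp)
  define D where "D = h * (1 / (1 + s powr \<nu> / lam) * (\<nu> * s powr (\<nu> - 1) / lam))"
  have "((\<lambda>s. 1 + s powr \<nu> / lam) has_real_derivative \<nu> * s powr (\<nu> - 1) / lam) (at s)"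
    using \<open>0 < s\<close> par by (auto intro!: derivative_eq_intros)
  then have D: "(ml_exponent \<nu> h lam has_real_derivative D) (at s)"
    unfolding ml_exponent_def[abs_def] D_def
    by (intro DERIV_cmult DERIV_chain2[where f = ln and g = "\<lambda>s. 1 + s powr \<nu> / lam"] DERIV_ln_divide dnz)
  then have "(g has_real_derivative (D - x)) (at s)"
    unfolding g_def by (auto intro!: derivative_eq_intros)
  then have "D - x = 0"
    by (rule DERIV_local_max[OF _ \<open>0 < s\<close>]) (auto intro!: max)
  moreover have "fenchel_legendre \<kappa> x = ereal (g s)"
    using ml_rate_le[of x "g s"] ml_rate_ge[of s x] max \<open>0 < s\<close> by (auto simp: g_def intro!: antisym)
  ultimately show thesis using that \<open>0 < s\<close> D by (simp add: g_def)
qed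

text \<open>For \<open>x \<le> 0\<close> the term \<open>- s * x\<close> is nonnegative, and the
  exponent is unbounded.\<close>

lemma ml_rate_nonpos:
  assumes "x \<le> 0"
  shows "fenchel_legendre \<kappa> x = \<infinity>"
proof (rule ereal_top)
  fix B :: real
  have "filterlim (ml_exponent \<nu> h lam) at_top at_top"
    unfolding ml_exponent_def[abs_def] using par by real_asymp
  then have "\<forall>\<^sub>F s in at_top. B \<le> ml_exponent \<nu> h lam s \<and> 0 \<le> s"
    by (intro eventually_conj eventually_ge_at_top) (simp add: filterlim_at_top)
  then obtain s where s: "B \<le> ml_exponent \<nu> h lam s" "0 \<le> s"
    using eventually_happens' trivial_limit_at_top_linorder by blast
  have "B \<le> ml_exponent \<nu> h lam s - s * x"
    using s(1) mult_nonneg_nonpos[OF s(2) assms] by linarith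
  then show "ereal B \<le> fenchel_legendre \<kappa> x"
    using ml_rate_ge[OF s(2), of x] by (meson ereal_less_eq(3) order_trans)
qed

lemma ml_rate_strict_antimono: "strict_antimono_on {0<..} (fenchel_legendre \<kappa>)"
proof (rule monotone_onI)
  fix x y :: real assume "x \<in> {0<..}" "y \<in> {0<..}" "x < y"
  then obtain s where s: "0 < s" "fenchel_legendre \<kappa> y = ereal (ml_exponent \<nu> h lam s - s * y)"
    using ml_rate_attained[of y] by auto
  have "fenchel_legendre \<kappa> y < ereal (ml_exponent \<nu> h lam s - s * x)"
    using s \<open>x < y\<close> by simp
  also have "\<dots> \<le> fenchel_legendre \<kappa> x" using s by (intro ml_rate_ge) simp
  finally show "fenchel_legendre \<kappa> x > fenchel_legendre \<kappa> y" .
qed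

lemma ml_rate_nonneg: "0 \<le> fenchel_legendre \<kappa> x"
  using ml_rate_ge[of 0 x] by (simp add: ml_exponent_def zero_ereal_def)

lemma ml_rate_tendsto_0: "(fenchel_legendre \<kappa> \<longlongrightarrow> 0) at_top"
proof (rule order_tendstoI)
  fix a :: ereal assume "a < 0"
  then show "\<forall>\<^sub>F x in at_top. a < fenchel_legendre \<kappa> x"
    by (intro always_eventually allI less_le_trans[OF _ ml_rate_nonneg])
next
  fix a :: ereal assume "0 < a"
  then obtain \<epsilon> where \<epsilon>: "0 < \<epsilon>" "ereal \<epsilon> < a"
    using ereal_dense2[of 0 a] by (auto simp: zero_ereal_def)
  have "(ml_exponent \<nu> h lam \<longlongrightarrow> 0) (at_right 0)"
    unfolding ml_exponent_def[abs_def] using par by real_asymp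
  then have "\<forall>\<^sub>F s in at_right 0. ml_exponent \<nu> h lam s < \<epsilon> \<and> 0 < s"
    by (intro eventually_conj eventually_at_right_less order_tendstoD(2)[OF _ \<epsilon>(1)])
  then obtain s0 where s0: "ml_exponent \<nu> h lam s0 < \<epsilon>" "0 < s0"
    using eventually_happens' trivial_limit_at_right_real by blast
  \<comment> \<open>Up to \<open>s0\<close> the exponent stays below \<epsilon> by monotonicity.
    Beyond \<open>s0\<close> it is at most \<open>h * (1 + s) / lam\<close>, and
    \<open>1 + s \<le> s * (1 / s0 + 1)\<close> bounds this by \<open>s * y\<close>; for
    \<open>x \<ge> y\<close> the linear term compensates.\<close>
  define y where "y = h / lam * (1 / s0 + 1)"
  have "fenchel_legendre \<kappa> x < a" if "y \<le> x" for x
  proof -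
    have "0 \<le> y" using par s0 by (simp add: y_def)
    have "ml_exponent \<nu> h lam s - s * x \<le> \<epsilon>" if "0 \<le> s" for s
    proof (cases "s \<le> s0")
      case True
      then have "ml_exponent \<nu> h lam s \<le> ml_exponent \<nu> h lam s0"
        unfolding ml_exponent_def using par \<open>0 \<le> s\<close>
        by (intro mult_left_mono ln_mono add_left_mono divide_right_mono powr_mono2) (auto simp: add_pos_nonneg)
      moreover have "0 \<le> s * x" using \<open>0 \<le> s\<close> \<open>0 \<le> y\<close> \<open>y \<le> x\<close> by simp
      ultimately show ?thesis using s0 by linarith
    next
      case False
      have "s powr \<nu> \<le> 1 + s"
      proof (cases "s \<le> 1")
        case True
        then have "s powr \<nu> \<le> 1" using par \<open>0 \<le> s\<close> by (intro powr_le1) auto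
        then show ?thesis using \<open>0 \<le> s\<close> by simp
      next
        case False
        then have "s powr \<nu> \<le> s powr 1" using par by (intro powr_mono) auto
        then show ?thesis using \<open>0 \<le> s\<close> by simp
      qed
      then have "s powr \<nu> / lam \<le> (1 + s) / lam" using par by (simp add: divide_right_mono)
      moreover have "ln (1 + s powr \<nu> / lam) \<le> s powr \<nu> / lam"
        using par by (intro ln_add_one_self_le_self) simp
      ultimately have "ml_exponent \<nu> h lam s \<le> h * ((1 + s) / lam)"
        unfolding ml_exponent_def using par by (intro mult_left_mono) auto
      also have "(1 + s) / lam \<le> s * (1 / s0 + 1) / lam"
        using False s0 par by (intro divide_right_mono) (auto simp: field_simps)
      then have "h * ((1 + s) / lam) \<le> h * (s * (1 / s0 + 1) / lam)"
        using par by (intro mult_left_mono) auto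
      also have "\<dots> = s * y" by (simp add: y_def)
      also have "\<dots> \<le> s * x" using \<open>y \<le> x\<close> \<open>0 \<le> s\<close> by (rule mult_left_mono)
      finally show ?thesis using \<epsilon> by simp
    qed
    then have "fenchel_legendre \<kappa> x \<le> ereal \<epsilon>" by (rule ml_rate_le)
    then show ?thesis using \<epsilon>(2) by simp
  qed
  then show "\<forall>\<^sub>F x in at_top. fenchel_legendre \<kappa> x < a"
    unfolding eventually_at_top_linorder by blast
qed

lemma ml_rate_not_compact: "\<not> compact_level_sets (fenchel_legendre \<kappa>)"
proof
  assume "compact_level_sets (fenchel_legendre \<kappa>)"
  then have "compact {x. fenchel_legendre \<kappa> x \<le> ereal 1}"
    by (simp add: compact_level_sets_def del: ereal_less_eq)
  then have "bounded {x. fenchel_legendre \<kappa> x \<le> ereal 1}" by (rule compact_imp_bounded)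
  then obtain b where b: "\<And>x. fenchel_legendre \<kappa> x \<le> ereal 1 \<Longrightarrow> \<bar>x\<bar> \<le> b"
    by (auto simp: bounded_iff)
  have "\<forall>\<^sub>F x in at_top. fenchel_legendre \<kappa> x < ereal 1 \<and> b + 1 \<le> x"
    by (intro eventually_conj order_tendstoD[OF ml_rate_tendsto_0] eventually_ge_at_top) simp
  then obtain x where "fenchel_legendre \<kappa> x < ereal 1" "b + 1 \<le> x"
    using eventually_happens' trivial_limit_at_top_linorder by blast
  with b[of x] show False by (simp add: less_imp_le)
qed

end

section \<open>Legendre transform of the Gamma cumulant function, \<nu> = 1\<close>

lemma gamma_rate:
  assumes "0 < h" "0 < lam"
    and \<kappa>: "\<And>\<theta>. \<kappa> \<theta> = (if \<theta> < lam then ereal (h * ln (lam / (lam - \<theta>))) else \<infinity>)"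
  shows "fenchel_legendre \<kappa> x = (if 0 < x then ereal (h * (lam * x / h - 1 - ln (lam * x / h))) else \<infinity>)"
proof (cases "0 < x")
  case True
  let ?v = "h * (lam * x / h - 1 - ln (lam * x / h))"
  have "fenchel_legendre \<kappa> x \<le> ereal ?v"
  proof (rule fenchel_legendre_le)
    fix \<theta> r assume "\<kappa> \<theta> = ereal r"
    then have r: "\<theta> < lam" "r = h * ln (lam / (lam - \<theta>))" by (auto simp: \<kappa> split: if_splits)
    define s where "s = lam - \<theta>"
    have s: "0 < s" "\<theta> = lam - s" "r = h * (ln lam - ln s)"
      using r assms by (auto simp: s_def ln_div)
    \<comment> \<open>Equality holds for \<open>s = h / x\<close>, which is the maximiser \<theta> =
      \<open>lam - h / x\<close> used for the reverse inequality.\<close>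
    have "ln (s * x / h) \<le> s * x / h - 1" using s True assms by (intro ln_le_minus_one) simp
    then have "h * (ln s + ln x - ln h) \<le> h * (s * x / h - 1)"
      using s True assms by (intro mult_left_mono) (auto simp: ln_mult ln_div)
    then show "\<theta> * x - r \<le> ?v"
      using True assms(1,2) s(1) unfolding s(2,3) by (simp add: ln_mult ln_div algebra_simps)
  qed (simp add: \<kappa>)
  moreover have "ereal ?v \<le> fenchel_legendre \<kappa> x"
    using fenchel_legendre_upper[of "lam - h / x" x \<kappa>] True assms
    by (simp add: \<kappa> ln_mult ln_div algebra_simps)
  ultimately show ?thesis using True by (simp add: antisym)
next
  case False
  have "fenchel_legendre \<kappa> x = \<infinity>"
  proof (rule ereal_top)
    fix B :: real
    \<comment> \<open>Solves \<open>h * ln (s / lam) = \<bar>B\<bar>\<close>; as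
      \<open>s \<ge> lam\<close>, the parameter \<open>lam - s\<close> is nonpositive and its
      product with \<open>x \<le> 0\<close> does no harm.\<close>
    define s where "s = lam * exp (\<bar>B\<bar> / h)"
    have "lam \<le> s" using assms mult_left_mono[of 1 "exp (\<bar>B\<bar> / h)" lam] by (simp add: s_def)
    have "0 \<le> (lam - s) * x" using False \<open>lam \<le> s\<close> by (intro mult_nonpos_nonpos) auto
    moreover have "h * ln (lam / s) = - \<bar>B\<bar>"
      using assms by (simp add: s_def ln_div ln_mult)
    ultimately have "ereal B \<le> ereal ((lam - s) * x) - \<kappa> (lam - s)"
      using assms \<open>lam \<le> s\<close> by (auto simp: \<kappa>)
    then show "ereal B \<le> fenchel_legendre \<kappa> x" using fenchel_legendre_upper by (rule order_trans)
  qed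
  then show ?thesis using False by simp
qed

lemma compact_level_sets_gamma_rate:
  assumes "0 < h" "0 < lam" and "lower_semicontinuous I"
    and I: "\<And>x. I x = (if 0 < x then ereal (h * (lam * x / h - 1 - ln (lam * x / h))) else \<infinity>)"
  shows "compact_level_sets I"
  unfolding compact_level_sets_def
proof (intro allI impI)
  fix \<eta> :: real
  \<comment> \<open>With \<open>u = lam * x / h\<close>, the tangent of the logarithm at 2 gives
    \<open>u - 1 - ln u \<ge> u / 2 - ln 2\<close>, a linear lower bound that confines the level
    set.\<close>
  define b where "b = 2 * h / lam * (\<eta> / h + ln 2)"
  have "{x. I x \<le> ereal \<eta>} \<subseteq> {0..b}"
  proof
    fix x assume "x \<in> {x. I x \<le> ereal \<eta>}"
    then have x: "0 < x" "h * (lam * x / h - 1 - ln (lam * x / h)) \<le> \<eta>"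
      by (auto simp: I split: if_splits)
    define u where "u = lam * x / h"
    have "0 < u" using x assms by (simp add: u_def)
    have "ln (u / 2) \<le> u / 2 - 1" using \<open>0 < u\<close> by (intro ln_le_minus_one) simp
    then have "u / 2 - ln 2 \<le> u - 1 - ln u" using \<open>0 < u\<close> by (simp add: ln_div)
    also have "u - 1 - ln u \<le> \<eta> / h" using x assms by (simp add: u_def field_simps)
    finally have "u \<le> 2 * (\<eta> / h + ln 2)" by simp
    then have "h / lam * u \<le> h / lam * (2 * (\<eta> / h + ln 2))"
      using assms by (intro mult_left_mono) auto
    then show "x \<in> {0..b}" using x assms(1,2) by (simp add: u_def b_def mult_ac)
  qed
  then have "bounded {x. I x \<le> ereal \<eta>}" by (rule bounded_subset[rotated]) simp
  then show "compact {x. I x \<le> ereal \<eta>}"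
    using closed_sublevel_of_lower_semicontinuous[OF assms(3)] by (simp add: compact_eq_bounded_closed)
qed

section \<open>Moment generating function of the Mittag-Leffler law and the large deviation
  principle\<close>

locale iid_ml = iid_sequence M T for M :: "'a measure" and T +
  fixes \<nu> h lam :: real
  assumes par: "0 < \<nu>" "\<nu> \<le> 1" "0 < h" "0 < lam"
    and dens: "distributed M lborel (T 1) (\<lambda>t. ennreal (ml_density \<nu> h lam t))"
begin

lemma mgf_density:
  "mgf \<theta> = (\<integral>\<^sup>+ t. ennreal (ml_density \<nu> h lam t) * ennreal (exp (\<theta> * t)) \<partial>lborel)"
  unfolding mgf_def by (rule distributed_nn_integral[OF dens, symmetric]) simp

lemma mgf_neg:
  assumes "0 < s"
  shows "mgf (- s) = ennreal ((lam / (lam + s powr \<nu>)) powr h)"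
proof -
  define F where "F = (\<lambda>z. exp (- of_real h * Ln (1 + z powr of_real \<nu> / of_real lam)))"
  have F: "F holomorphic_on {z. 0 < Re z}"
    "0 < s \<Longrightarrow> Re (F (of_real s)) = (lam / (lam + s powr \<nu>)) powr h" for s
    unfolding F_def using par by (intro ml_laplace_holomorphic; simp)+
  have "mgf (- s) = (\<integral>\<^sup>+ t. ennreal (ml_density \<nu> h lam t) * ennreal (exp (- s * t)) \<partial>lborel)"
    by (rule mgf_density)
  also have "\<dots> = ennreal (Re (F (of_real s)))"
  \<comment> \<open>Beyond this abscissa \<open>s powr \<nu> > lam\<close>, the range of termwise
    integration.\<close>
  proof (rule laplace_continuation[where c = "lam powr (1 / \<nu>)"])
    show "(\<integral>\<^sup>+ t. ennreal (ml_density \<nu> h lam t) \<partial>lborel) \<le> 1"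
      using mgf_density[of 0] mgf_0 by simp
    show "has_bochner_integral lborel (\<lambda>t. ml_density \<nu> h lam t * exp (- s * t)) (Re (F (of_real s)))"
      if "lam powr (1 / \<nu>) < s" for s
    proof -
      have "0 < s" using that by (meson le_less_trans powr_ge_zero)
      have "(lam powr (1 / \<nu>)) powr \<nu> < s powr \<nu>" using that par by (intro powr_less_mono2) auto
      then have "lam < s powr \<nu>" using par by (simp add: powr_powr)
      then have "lam * s powr (- \<nu>) < 1"
        using \<open>0 < s\<close> by (simp add: powr_minus field_simps)
      then show ?thesis
        using laplace_ml_density[of \<nu> h lam s] par \<open>0 < s\<close> F(2) by simp
    qed
    have "((\<lambda>s. (lam / (lam + s powr \<nu>)) powr h) \<longlongrightarrow> 1) (at_right 0)"
      using par by real_asymp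
    moreover have "\<forall>\<^sub>F s in at_right 0. (lam / (lam + s powr \<nu>)) powr h = Re (F (of_real s))"
      using eventually_at_right_less[of 0] by eventually_elim (simp add: F(2))
    ultimately show "((\<lambda>s. Re (F (of_real s))) \<longlongrightarrow> 1) (at_right 0)"
      by (rule Lim_transform_eventually)
    show "ml_density \<nu> h lam t = 0" if "t < 0" for t
      using that by (simp add: ml_density_def)
  qed (fact borel_measurable_ml_density F(1) assms)+
  finally show ?thesis using F(2)[OF assms] by simp
qed

lemma mgf_pos:
  assumes "\<nu> < 1" and "0 < \<theta>"
  shows "mgf \<theta> = \<top>"
proof (rule ccontr)
  assume "mgf \<theta> \<noteq> \<top>"
  then obtain K where K: "mgf \<theta> = ennreal K" "0 \<le> K" by (cases "mgf \<theta>") auto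
  txt \<open>A finite exponential moment would bound the slope of the Laplace transform at \<open>0\<close>.\<close>
  have "(1 - (lam / (lam + s powr \<nu>)) powr h) / s \<le> K / \<theta>" if "0 < s" for s
  proof -
    \<comment> \<open>Both exponentials lie above their tangents at 0, and the linear terms
      cancel.\<close>
    have "1 \<le> exp (- s * x) + s / \<theta> * exp (\<theta> * x)" for x
    proof -
      have "s / \<theta> * (\<theta> * x) \<le> s / \<theta> * exp (\<theta> * x)"
        using that \<open>0 < \<theta>\<close> exp_ge_add_one_self[of "\<theta> * x"] by (intro mult_left_mono) (linarith, simp)
      then show ?thesis using exp_ge_add_one_self[of "- s * x"] \<open>0 < \<theta>\<close> by simp
    qed
    then have "1 \<le> ennreal (exp (- s * x)) + ennreal (s / \<theta>) * ennreal (exp (\<theta> * x))" for x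
      using that \<open>0 < \<theta>\<close> by (simp flip: ennreal_mult ennreal_plus ennreal_1)
    then have "(\<integral>\<^sup>+ \<omega>. 1 \<partial>M)
        \<le> (\<integral>\<^sup>+ \<omega>. ennreal (exp (- s * T 1 \<omega>)) + ennreal (s / \<theta>) * ennreal (exp (\<theta> * T 1 \<omega>)) \<partial>M)"
      by (intro nn_integral_mono)
    also have "\<dots> = mgf (- s) + ennreal (s / \<theta>) * mgf \<theta>"
      unfolding mgf_def by (subst nn_integral_add) (simp_all add: nn_integral_cmult)
    finally have "ennreal 1 \<le> ennreal ((lam / (lam + s powr \<nu>)) powr h + s / \<theta> * K)"
      using that \<open>0 < \<theta>\<close> K by (simp add: emeasure_space_1 mgf_neg flip: ennreal_mult ennreal_plus)
    then have "1 \<le> (lam / (lam + s powr \<nu>)) powr h + s / \<theta> * K"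
      using that \<open>0 < \<theta>\<close> K by (subst (asm) ennreal_le_iff) simp_all
    then show ?thesis using that \<open>0 < \<theta>\<close> by (simp add: field_simps)
  qed
  then have le: "\<forall>\<^sub>F s in at_right 0. (1 - (lam / (lam + s powr \<nu>)) powr h) / s \<le> K / \<theta>"
    using eventually_at_right_less[of 0] by (auto elim: eventually_mono)
  \<comment> \<open>The quotient behaves like \<open>h / lam * s powr (\<nu> - 1)\<close> near
    0.\<close>
  have "filterlim (\<lambda>s. (1 - (lam / (lam + s powr \<nu>)) powr h) / s) at_top (at_right 0)"
    using par \<open>\<nu> < 1\<close> by real_asymp
  then have "\<forall>\<^sub>F s in at_right 0. K / \<theta> < (1 - (lam / (lam + s powr \<nu>)) powr h) / s"
    by (simp add: filterlim_at_top_dense)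
  with le have "\<forall>\<^sub>F s::real in at_right 0. False" by eventually_elim simp
  then show False by simp
qed

lemma log_mgf_less_1:
  assumes "\<nu> < 1"
  shows "log_mgf M (T 1) \<theta> = (if \<theta> \<le> 0 then ereal (- ml_exponent \<nu> h lam (- \<theta>)) else \<infinity>)"
proof -
  consider "\<theta> < 0" | "\<theta> = 0" | "0 < \<theta>" by linarith
  then show ?thesis
  proof cases
    case 1
    have "lam / (lam + (- \<theta>) powr \<nu>) = 1 / (1 + (- \<theta>) powr \<nu> / lam)"
      using par by (simp add: field_simps)
    moreover have "0 < 1 + (- \<theta>) powr \<nu> / lam" using par by (simp add: add_pos_nonneg)
    ultimately have "(lam / (lam + (- \<theta>) powr \<nu>)) powr h = exp (- ml_exponent \<nu> h lam (- \<theta>))"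
      by (simp add: ml_exponent_def powr_def ln_div)
    then have "log_mgf M (T 1) \<theta> = ereal (- ml_exponent \<nu> h lam (- \<theta>))"
      unfolding log_mgf_eq ext_ln_eq_ereal_iff using mgf_neg[of "- \<theta>"] 1 by simp
    then show ?thesis using 1 by simp
  next
    case 2
    have "log_mgf M (T 1) 0 = ereal 0"
      unfolding log_mgf_eq ext_ln_eq_ereal_iff by (simp add: mgf_0)
    then show ?thesis using 2 by (simp add: ml_exponent_def)
  next
    case 3
    have "log_mgf M (T 1) \<theta> = \<infinity>" unfolding log_mgf_eq mgf_pos[OF assms 3] by simp
    then show ?thesis using 3 by simp
  qed
qed

lemma log_mgf_1:
  assumes "\<nu> = 1"
  shows "log_mgf M (T 1) \<theta> = (if \<theta> < lam then ereal (h * ln (lam / (lam - \<theta>))) else \<infinity>)"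
proof -
  have lt: "mgf \<theta> = ennreal ((lam / (lam - \<theta>)) powr h)" if "\<theta> < lam" for \<theta>
  proof -
    have "0 < Gamma h" using par by (intro Gamma_real_pos)
    then obtain G where G: "Gamma h = G" "0 < G" by blast
    have "mgf \<theta> = (\<integral>\<^sup>+ t. ennreal (lam powr h / Gamma h)
        * ennreal (indicator {0<..} t * t powr (h - 1) * exp (- (lam - \<theta>) * t)) \<partial>lborel)"
      unfolding mgf_density
    proof (intro nn_integral_cong)
      fix t
      have "ml_density \<nu> h lam t * exp (\<theta> * t) = lam powr h / Gamma h
          * (indicator {0<..} t * t powr (h - 1) * exp (- (lam - \<theta>) * t))"
        using par by (simp add: assms ml_density_1 left_diff_distrib exp_diff exp_minus field_simps)
      then show "ennreal (ml_density \<nu> h lam t) * ennreal (exp (\<theta> * t)) = ennreal (lam powr h / Gamma h)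
        * ennreal (indicator {0<..} t * t powr (h - 1) * exp (- (lam - \<theta>) * t))"
        using \<open>0 < Gamma h\<close> by (simp flip: ennreal_mult'' ennreal_mult')
    qed
    also have "\<dots> = ennreal (lam powr h / Gamma h) * ennreal (Gamma h / (lam - \<theta>) powr h)"
      using par that by (subst nn_integral_cmult) (simp_all only: nn_integral_powr_exp diff_gt_0_iff_gt, measurable)
    also have "\<dots> = ennreal ((lam / (lam - \<theta>)) powr h)"
      unfolding G(1) using par that G(2)
      by (simp add: powr_divide flip: ennreal_mult)
    finally show ?thesis .
  qed
  have ge: "mgf \<theta> = \<top>" if "lam \<le> \<theta>" for \<theta>
  proof (rule ccontr)
    assume "mgf \<theta> \<noteq> \<top>"
    then obtain K where K: "mgf \<theta> = ennreal K" "0 \<le> K" by (cases "mgf \<theta>") auto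
    \<comment> \<open>Chosen so that the moment generating function at \<open>lam - s\<close> equals
      \<open>K + 1\<close>; monotonicity in the parameter then contradicts the value
      \<open>K\<close> at \<theta>.\<close>
    define s where "s = lam / (K + 1) powr (1 / h)"
    have "0 < s" using par K by (simp add: s_def)
    have "ennreal ((lam / (lam - (lam - s))) powr h) = mgf (lam - s)"
      using \<open>0 < s\<close> by (intro lt[symmetric]) simp
    also have "\<dots> \<le> mgf \<theta>"
      unfolding mgf_density
    proof (intro nn_integral_mono)
      fix t
      show "ennreal (ml_density \<nu> h lam t) * ennreal (exp ((lam - s) * t))
          \<le> ennreal (ml_density \<nu> h lam t) * ennreal (exp (\<theta> * t))"
        using \<open>0 < s\<close> that
        by (cases "0 < t") (auto simp: ml_density_def intro!: mult_left_mono ennreal_leI mult_right_mono)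
    qed
    also have "(lam / (lam - (lam - s))) powr h = K + 1"
      using par K by (simp add: s_def powr_powr)
    finally show False using K by simp
  qed
  show ?thesis
  proof (cases "\<theta> < lam")
    case True
    then have "(lam / (lam - \<theta>)) powr h = exp (h * ln (lam / (lam - \<theta>)))"
      using par by (simp add: powr_def)
    then have "log_mgf M (T 1) \<theta> = ereal (h * ln (lam / (lam - \<theta>)))"
      unfolding log_mgf_eq ext_ln_eq_ereal_iff using lt[OF True] by simp
    then show ?thesis using True by simp
  next
    case False
    then show ?thesis unfolding log_mgf_eq using ge[of \<theta>] by simp
  qed
qed

lemma LDP: "satisfies_LDP M (sample_mean T) (fenchel_legendre (log_mgf M (T 1)))"
proof (rule cramer_exposed)
  fix x assume fin: "fenchel_legendre (log_mgf M (T 1)) x < \<infinity>"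
  show "\<exists>\<theta> e k. 0 < e \<and> (\<forall>\<eta>. \<bar>\<eta>\<bar> < e \<longrightarrow> log_mgf M (T 1) (\<theta> + \<eta>) = ereal (k (\<theta> + \<eta>)))
      \<and> (k has_real_derivative x) (at \<theta>)"
  proof (cases "\<nu> = 1")
    case True
    have "0 < x" using fin unfolding gamma_rate[OF par(3,4) log_mgf_1[OF True]] by (simp split: if_splits)
    \<comment> \<open>The solution of \<open>h / (lam - \<theta>) = x\<close>. Its distance to the
      pole \<open>lam\<close> is \<open>h / x\<close>, which serves as the radius.\<close>
    define \<theta> where "\<theta> = lam - h / x"
    have "((\<lambda>\<theta>. h * ln (lam / (lam - \<theta>))) has_real_derivative x) (at \<theta>)"
      using par \<open>0 < x\<close> by (auto intro!: derivative_eq_intros simp: \<theta>_def field_simps power2_eq_square)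
    moreover have "log_mgf M (T 1) (\<theta> + \<eta>) = ereal (h * ln (lam / (lam - (\<theta> + \<eta>))))" if "\<bar>\<eta>\<bar> < h / x" for \<eta>
      unfolding log_mgf_1[OF True] using that by (auto simp: \<theta>_def)
    moreover have "0 < h / x" using par \<open>0 < x\<close> by simp
    ultimately show ?thesis
      by (intro exI[of _ \<theta>] exI[of _ "h / x"] exI[of _ "\<lambda>\<theta>. h * ln (lam / (lam - \<theta>))"]) blast
  next
    case False
    then have "\<nu> < 1" using par by simp
    note L = par(1) \<open>\<nu> < 1\<close> par(3,4) log_mgf_less_1[OF \<open>\<nu> < 1\<close>]
    have "0 < x" using fin ml_rate_nonpos[OF L, of x] by (cases "x \<le> 0") auto
    obtain s where s: "0 < s" "(ml_exponent \<nu> h lam has_real_derivative x) (at s)"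
      using ml_rate_attained[OF L \<open>0 < x\<close>] by blast
    \<comment> \<open>The two reflections leave the slope unchanged, and the radius \<open>s\<close>
      keeps the parameter negative.\<close>
    have "((\<lambda>\<theta>. - ml_exponent \<nu> h lam (- \<theta>)) has_real_derivative x) (at (- s))"
      using s(2) by (auto intro!: derivative_eq_intros DERIV_chain2[where f = "ml_exponent \<nu> h lam" and g = uminus])
    moreover have "log_mgf M (T 1) (- s + \<eta>) = ereal (- ml_exponent \<nu> h lam (- (- s + \<eta>)))" if "\<bar>\<eta>\<bar> < s" for \<eta>
      unfolding log_mgf_less_1[OF \<open>\<nu> < 1\<close>] using that by auto
    ultimately show ?thesis
      using s(1) by (intro exI[of _ "- s"] exI[of _ s] exI[of _ "\<lambda>\<theta>. - ml_exponent \<nu> h lam (- \<theta>)"]) blast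
  qed
qed

end

theorem proposition3p1:
  fixes M :: "'a measure" and T :: "nat \<Rightarrow> 'a \<Rightarrow> real"
    and \<nu> h lam :: real and I :: "real \<Rightarrow> ereal"
  assumes "0 < \<nu>" and "\<nu> \<le> 1" and "0 < h" and "0 < lam"
    and "prob_space M"
    and "prob_space.indep_vars M (\<lambda>_. borel) T {1..}"
    and "\<And>n. 1 \<le> n \<Longrightarrow> distributed M lborel (T n) (\<lambda>t. ennreal (ml_density \<nu> h lam t))"
  defines "I \<equiv> fenchel_legendre (log_mgf M (T 1))"
  shows "satisfies_LDP M (sample_mean T) I
    \<and> (\<nu> = 1 \<longrightarrow>
         (\<forall>x. I x = (if 0 < x then ereal (h * (lam * x / h - 1 - ln (lam * x / h))) else \<infinity>))
         \<and> good_rate_function I)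
    \<and> (\<nu> < 1 \<longrightarrow>
         (\<forall>x\<le>0. I x = \<infinity>)
         \<and> strict_antimono_on {0<..} I
         \<and> (I \<longlongrightarrow> \<infinity>) (at_right 0)
         \<and> (I \<longlongrightarrow> 0) at_top
         \<and> \<not> compact_level_sets I)"
proof -
  interpret prob_space M by fact
  interpret iid_ml M T \<nu> h lam
  proof
    fix n :: nat assume "1 \<le> n"
    have "distr M borel (T m) = density lborel (\<lambda>t. ennreal (ml_density \<nu> h lam t))" if "1 \<le> m" for m
    proof -
      have "distr M borel (T m) = distr M lborel (T m)" by (rule distr_cong) simp_all
      then show ?thesis using distributed_distr_eq_density[OF assms(7)[OF that]] by simp
    qed
    then show "distr M borel (T n) = distr M borel (T 1)" using \<open>1 \<le> n\<close> by simp
  qed (use assms in simp_all)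
  have lsc: "lower_semicontinuous I"
    unfolding I_def by (rule lower_semicontinuous_fenchel_legendre)
  have "(\<forall>x. I x = (if 0 < x then ereal (h * (lam * x / h - 1 - ln (lam * x / h))) else \<infinity>))
         \<and> good_rate_function I" if "\<nu> = 1"
  proof -
    have "I x = (if 0 < x then ereal (h * (lam * x / h - 1 - ln (lam * x / h))) else \<infinity>)" for x
      unfolding I_def by (rule gamma_rate[OF par(3,4) log_mgf_1[OF that]])
    moreover from compact_level_sets_gamma_rate[OF par(3,4) lsc this] have "good_rate_function I"
      using rate_function_fenchel_legendre by (simp add: good_rate_function_def I_def)
    ultimately show ?thesis by blast
  qed
  moreover have "(\<forall>x\<le>0. I x = \<infinity>) \<and> strict_antimono_on {0<..} I \<and> (I \<longlongrightarrow> \<infinity>) (at_right 0)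
         \<and> (I \<longlongrightarrow> 0) at_top \<and> \<not> compact_level_sets I" if "\<nu> < 1"
  proof -
    note L = par(1) that par(3,4) log_mgf_less_1[OF that]
    have "\<forall>x\<le>0. I x = \<infinity>" unfolding I_def using ml_rate_nonpos[OF L] by blast
    moreover from this have "(I \<longlongrightarrow> \<infinity>) (at_right 0)"
      by (intro at_right_limit_of_lower_semicontinuous lsc) simp
    ultimately show ?thesis
      unfolding I_def
      using ml_rate_strict_antimono[OF L] ml_rate_tendsto_0[OF L] ml_rate_not_compact[OF L] by blast
  qed
  ultimately show ?thesis using LDP unfolding I_def by blast
qed

end
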